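(* Let $K$ be an algebraic number field with $r_1$ real places and $r_2$ complex places, let $G_K(s)$ be as defined in the context, and let $n\ge 0$ be an integer. (1) If $n$ is even, then $G_K(n)\notin\overline{\mathbb{Q}}$. (2) If $n$ is odd, then $G_K(n)\notin\overline{\mathbb{Q}}$ if and only if $r_2\ge 1$; equivalently, $G_K(n)\in\overline{\mathbb{Q}}$ if and only if $r_2=0$ (i.e. $K$ is totally real).
   Context: Let $A$ be the ring of integers of $K$ and $K_n(A)$ Quillen's higher $K$-groups; by Borel, for $n>1$, $\operatorname{rank}K_n(A)=r_1+r_2$ if $n\equiv1\pmod 4$, $r_2$ if $n\equiv 3\pmod 4$, and $0$ otherwise. The Riemann operator $\mathcal{R}$ acts on $K_n(A)_{\mathbb{C}}$ by the scalar $\frac{1-n}{2}$, and $G_K(s)=\det\bigl((sI-\mathcal{R})\mid\bigoplus_{n>1}K_n(A)_{\mathbb{C}}\bigr)$ is the zeta-regularized determinant: $G_K(s)=\exp\bigl(-\frac{\partial}{\partial w}\varphi(w,s)\big|_{w=0}\bigr)$, where $\varphi(w,s)=(r_1+r_2)\sum_{m>1,\,m\equiv1 (4)}\bigl(\tfrac{m-1}{2}+s\bigr)^{-w}+r_2\sum_{m\equiv 3 (4)}\bigl(\tfrac{m-1}{2}+s\bigr)^{-w}$ (analytically continued in $w$). $\overline{\mathbb{Q}}$ denotes the field of algebraic numbers. *)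

theory Defs
  imports "HOL-Complex_Analysis.Complex_Analysis"
begin

definition number_field :: "'k::field_char_0 itself \<Rightarrow> bool" where
  "number_field _ \<longleftrightarrow>
     (\<exists>B. finite_dimensional_vector_space (\<lambda>(q::rat) (x::'k). of_rat q * x) B)"

definition embeddings :: "('k::field_char_0 \<Rightarrow> complex) set" where
  "embeddings = {\<sigma>. \<sigma> 1 = 1 \<and> (\<forall>x y. \<sigma> (x + y) = \<sigma> x + \<sigma> y) \<and> (\<forall>x y. \<sigma> (x * y) = \<sigma> x * \<sigma> y)}"

text \<open>An archimedean place is represented by a conjugacy class of complex embeddings, which is a
  singleton exactly for the real places.\<close>

definition real_places :: "('k::field_char_0 \<Rightarrow> complex) set set" where
  "real_places = {{\<sigma>, cnj \<circ> \<sigma>} | \<sigma>. \<sigma> \<in> embeddings \<and> range \<sigma> \<subseteq> \<real>}"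

definition complex_places :: "('k::field_char_0 \<Rightarrow> complex) set set" where
  "complex_places = {{\<sigma>, cnj \<circ> \<sigma>} | \<sigma>. \<sigma> \<in> embeddings \<and> \<not> range \<sigma> \<subseteq> \<real>}"

definition r1 :: "'k::field_char_0 itself \<Rightarrow> nat" where
  "r1 _ = card (real_places :: ('k \<Rightarrow> complex) set set)"

definition r2 :: "'k::field_char_0 itself \<Rightarrow> nat" where
  "r2 _ = card (complex_places :: ('k \<Rightarrow> complex) set set)"

definition totally_real :: "'k::field_char_0 itself \<Rightarrow> bool" where
  "totally_real _ \<longleftrightarrow> (\<forall>\<sigma> \<in> (embeddings :: ('k \<Rightarrow> complex) set). range \<sigma> \<subseteq> \<real>)"

text \<open>The spectral zeta function of $sI - \mathcal{R}$ on $\bigoplus_{m>1} K_m(A)_{\mathbb{C}}$,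
  where $A$ is the ring of integers: $\mathcal{R}$ acts on $K_m(A)_{\mathbb{C}}$ as $(1-m)/2$, and the
  multiplicities are the ranks of the $K_m(A)$ as computed by Borel.
  The series converges for $\mathrm{Re}\, w > 1$. Powers use the principal branch; for
  $s \ge 0$ all bases are positive reals.\<close>

definition phi_series :: "'k::field_char_0 itself \<Rightarrow> complex \<Rightarrow> complex \<Rightarrow> complex" where
  "phi_series K w s =
     of_nat (r1 K + r2 K) *
       (\<Sum>\<^sub>\<infinity>m\<in>{m::nat. m > 1 \<and> m mod 4 = 1}. ((of_nat m - 1) / 2 + s) powr (- w)) +
     of_nat (r2 K) *
       (\<Sum>\<^sub>\<infinity>m\<in>{m::nat. m mod 4 = 3}. ((of_nat m - 1) / 2 + s) powr (- w))"

text \<open>The analytic continuation in $w$. It has its only pole at $w = 1$, and it is unique away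
  from that point; only the value at $w = 1$ is left unspecified by the choice operator.\<close>

definition phi :: "'k::field_char_0 itself \<Rightarrow> complex \<Rightarrow> complex \<Rightarrow> complex" where
  "phi K w s =
     (SOME F. F holomorphic_on (- {1}) \<and> (\<forall>z. Re z > 1 \<longrightarrow> F z = phi_series K z s)) w"

definition G :: "'k::field_char_0 itself \<Rightarrow> complex \<Rightarrow> complex" where
  "G K s = exp (- deriv (\<lambda>w. phi K w s) 0)"

definition Qbar :: "complex set" where
  "Qbar = {z. algebraic z}"

end

theory Submission
  imports Defs "HOL-Computational_Algebra.Computational_Algebra" "HOL-Real_Asymp.Real_Asymp"
begin

text \<open>The bases \<open>(m - 1) / 2 + n\<close> run over the integers beyond \<open>n\<close>, split by parity, so the spectral
  zeta function is a combination of \<open>2 powr (- w) * \<zeta>(w)\<close> and \<open>(1 - 2 powr (- w)) * \<zeta>(w)\<close> up to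
  finite sums. With \<open>\<zeta>(0) = - 1 / 2\<close> and \<open>\<zeta>'(0) = - ln (2 * pi) / 2\<close> each even factor contributes
  \<open>sqrt pi\<close> and each odd factor \<open>sqrt 2\<close> to the determinant, up to nonzero rationals. So the square
  of \<open>G K n\<close> is a nonzero rational times \<open>pi ^ (r1 + r2)\<close> for even \<open>n\<close> and \<open>pi ^ r2\<close> for odd \<open>n\<close>,
  and everything follows from the transcendence of \<open>pi\<close> and from \<open>r1 + r2 > 0\<close>.\<close>

text \<open>What decides whether pi survives is the value at \<open>w = 0\<close> of the factor in
  front of zeta: \<open>2 powr (- w)\<close> is 1 there and keeps the derivative of zeta, while
  \<open>1 - 2 powr (- w)\<close> vanishes there and removes it. So only the even integers produce
  pi, and the parity of \<open>n\<close> decides whether they occur with multiplicity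
  \<open>r1 + r2\<close> or \<open>r2\<close>. The derivative of zeta at 0 is reached without a
  functional equation. The Taylor remainders that continue zeta to the left vanish at the relevant
  points, and their derivatives in \<open>s\<close> add up to the logarithm of Stirling's formula;
  Wallis' product supplies the pi. Transcendence follows Lindemann's theorem in Niven's form: if
  \<open>i * pi\<close> were a root of a rational polynomial, the product of
  \<open>1 + exp x\<close> over all roots \<open>x\<close> would vanish. An estimate of exponential
  series replaces Hermite's integral. That \<open>r1 + r2 > 0\<close> amounts to the existence of a
  complex embedding, which is found by linear algebra.\<close>

subsection \<open>Analytic continuation of the Riemann zeta function\<close>

text \<open>The Taylor remainder of order \<open>n\<close> of \<open>x powr (1 - s)\<close> between the consecutive integers \<open>k\<close> and
  \<open>k + 1\<close>. Summed over \<open>k\<close> the first term telescopes, while the Taylor terms produce values of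
  zeta at \<open>s, s + 1, ..., s + n - 1\<close>.\<close>

definition falling :: "complex \<Rightarrow> nat \<Rightarrow> complex" where
  "falling a j = (\<Prod>i<j. a - of_nat i)"

definition zrem :: "nat \<Rightarrow> complex \<Rightarrow> nat \<Rightarrow> complex" where
  "zrem n s k = of_nat (Suc k) powr (1 - s) -
     (\<Sum>j\<le>n. falling (1 - s) j / fact j * of_nat k powr (1 - s - of_nat j))"

text \<open>Derivative number \<open>n + 1\<close> of \<open>u powr (1 - s)\<close> is
  \<open>falling (1 - s) (Suc n) * u powr (- s - n)\<close>. The condition
  \<open>Re s + n >= 0\<close> makes the modulus of this power decrease along the segment, so the
  left end point gives the bound. Each further Taylor term buys one more power of decay in
  \<open>k\<close>.\<close>

lemma norm_zrem_le:
  assumes "k > 0" "Re s + n \<ge> 0"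
  shows "norm (zrem n s k) \<le> (norm (1 - s) + n) ^ Suc n * real k powr (- Re s - n)"
proof -
  define f where "f i u = falling (1 - s) i * u powr (1 - s - of_nat i)" for i and u :: complex
  define S where "S = closed_segment (of_nat k :: complex) (of_nat (Suc k))"
  have S: "\<exists>t\<ge>real k. u = of_real t" if "u \<in> S" for u
  proof -
    have "S = of_real ` closed_segment (real k) (real (Suc k))"
      unfolding S_def closed_segment_of_real[symmetric] by simp
    then show ?thesis using that by (auto simp: closed_segment_eq_real_ivl)
  qed
  have "norm (f 0 (of_nat (Suc k)) - (\<Sum>i\<le>n. f i (of_nat k) * (of_nat (Suc k) - of_nat k) ^ i / fact i)) \<le> 
     ((norm (1 - s) + n) ^ Suc n * real k powr (- Re s - n)) * norm (of_nat (Suc k) - of_nat k :: complex) ^ Suc n / fact n"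
  proof (rule complex_Taylor[where S = S])
    show "convex S" unfolding S_def by simp
    show "of_nat k \<in> S" "of_nat (Suc k) \<in> S" unfolding S_def by auto
  next
    fix i u assume "u \<in> S"
    then obtain t where t: "t \<ge> real k" "u = of_real t" using S by blast
    then have "u \<notin> \<real>\<^sub>\<le>\<^sub>0" using assms by (auto simp: complex_nonpos_Reals_iff)
    then have "(f i has_field_derivative falling (1 - s) i * ((1 - s - of_nat i) * u powr (1 - s - of_nat i - 1))) (at u within S)"
      unfolding f_def by (intro DERIV_cmult has_field_derivative_at_within[OF has_field_derivative_powr])
    also have "falling (1 - s) i * ((1 - s - of_nat i) * u powr (1 - s - of_nat i - 1)) = f (Suc i) u"
      by (simp add: f_def falling_def algebra_simps)
    finally show "(f i has_field_derivative f (Suc i) u) (at u within S)" .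
  next
    fix u assume "u \<in> S"
    then obtain t where t: "t \<ge> real k" "u = of_real t" using S by blast
    have "norm (falling (1 - s) (Suc n)) = (\<Prod>i<Suc n. norm (1 - s - of_nat i))"
      unfolding falling_def by (rule prod_norm[symmetric])
    also have "\<dots> \<le> (\<Prod>i<Suc n. norm (1 - s) + n)"
    proof (intro prod_mono conjI)
      fix i assume i: "i \<in> {..<Suc n}"
      have "norm (1 - s - of_nat i) \<le> norm (1 - s) + norm (of_nat i :: complex)" by (rule norm_triangle_ineq4)
      also have "\<dots> \<le> norm (1 - s) + n" using i by (simp only: norm_of_nat) simp
      finally show "norm (1 - s - of_nat i) \<le> norm (1 - s) + n" .
    qed simp
    finally have 1: "norm (falling (1 - s) (Suc n)) \<le> (norm (1 - s) + n) ^ Suc n" by simp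
    have "norm (u powr (1 - s - of_nat (Suc n))) = t powr (- Re s - n)"
      using t assms by (subst norm_powr_real_powr) auto
    also have "\<dots> \<le> real k powr (- Re s - n)"
      using t assms by (intro powr_mono2') auto
    finally show "norm (f (Suc n) u) \<le> (norm (1 - s) + n) ^ Suc n * real k powr (- Re s - n)"
      unfolding f_def norm_mult by (intro mult_mono 1) auto
  qed
  also have "\<dots> \<le> (norm (1 - s) + n) ^ Suc n * real k powr (- Re s - n) * norm (of_nat (Suc k) - of_nat k :: complex) ^ Suc n / 1"
    by (intro divide_left_mono) (auto simp: fact_ge_1)
  also have "\<dots> = (norm (1 - s) + n) ^ Suc n * real k powr (- Re s - n)"
    by simp
  also have "f 0 (of_nat (Suc k)) - (\<Sum>i\<le>n. f i (of_nat k) * (of_nat (Suc k) - of_nat k) ^ i / fact i) = zrem n s k"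
    by (simp add: f_def zrem_def falling_def)
  finally show ?thesis .
qed

lemma zrem_uniform_limit:
  assumes "Re s > 1 - real n"
  shows "\<exists>d>0. cball s d \<subseteq> {s. Re s > 1 - real n} \<and>
    uniform_limit (cball s d) (\<lambda>N s. \<Sum>k<N. zrem n s (Suc k)) (\<lambda>s. \<Sum>k. zrem n s (Suc k)) sequentially"
proof -
  \<comment> \<open>Half the distance to the line \<open>Re s = 1 - n\<close>: the exponent
    \<open>- (Re s - d) - n\<close> of the majorant on the ball is then still below -1.\<close>
  define d where "d = (Re s - (1 - real n)) / 2"
  define C where "C = (norm (1 - s) + d + n) ^ Suc n"
  have d: "d > 0" using assms by (simp add: d_def)
  have b: "norm (zrem n z (Suc k)) \<le> C * real (Suc k) powr (- (Re s - d) - n)" if "z \<in> cball s d" for z k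
  proof -
    have z: "norm (s - z) \<le> d" using that by (simp add: dist_norm)
    have rz: "Re z \<ge> Re s - d" using abs_Re_le_cmod[of "s - z"] z by simp
    have "norm (1 - z) \<le> norm (1 - s) + norm (s - z)" using norm_triangle_ineq[of "1 - s" "s - z"] by simp
    then have 1: "norm (1 - z) + n \<le> norm (1 - s) + d + n" using z by simp
    have "Re z + n \<ge> 0" using rz assms unfolding d_def by argo
    then have "norm (zrem n z (Suc k)) \<le> (norm (1 - z) + n) ^ Suc n * real (Suc k) powr (- Re z - n)"
      by (intro norm_zrem_le) simp
    also have "\<dots> \<le> C * real (Suc k) powr (- (Re s - d) - n)"
      unfolding C_def using 1 rz d by (intro mult_mono power_mono powr_mono) auto
    finally show ?thesis .
  qed
  have "summable (\<lambda>k. real k powr (- (Re s - d) - n))"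
    using assms by (subst summable_real_powr_iff) (simp add: d_def field_simps)
  then have "summable (\<lambda>k. C * real (Suc k) powr (- (Re s - d) - n))"
    by (intro summable_mult) (subst summable_Suc_iff)
  from Weierstrass_m_test[OF b this] 
  have "uniform_limit (cball s d) (\<lambda>N s. \<Sum>k<N. zrem n s (Suc k)) (\<lambda>s. \<Sum>k. zrem n s (Suc k)) sequentially" .
  moreover have "cball s d \<subseteq> {s. Re s > 1 - real n}"
  proof
    fix z assume "z \<in> cball s d"
    then have "Re s - Re z \<le> d" using abs_Re_le_cmod[of "s - z"] by (simp add: dist_norm)
    then show "z \<in> {s. Re s > 1 - real n}" using assms by (simp add: d_def field_simps)
  qed
  ultimately show ?thesis using d by blast
qed

lemma holomorphic_falling [holomorphic_intros]:
  "f holomorphic_on S \<Longrightarrow> (\<lambda>s. falling (f s) j) holomorphic_on S"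
  unfolding falling_def by (intro holomorphic_intros)

lemma holomorphic_zrem_sum: "(\<lambda>s. \<Sum>k. zrem n s (Suc k)) holomorphic_on {s. Re s > 1 - real n}"
proof (rule holomorphic_uniform_sequence)
  show "open {s. Re s > 1 - real n}" by (simp add: open_halfspace_Re_gt)
  show "(\<lambda>s. \<Sum>k<N. zrem n s (Suc k)) holomorphic_on {s. Re s > 1 - real n}" for N
    unfolding zrem_def by (intro holomorphic_intros) auto
qed (use zrem_uniform_limit in auto)

lemma powr_neg_sums:
  assumes "Re s > 1"
  shows "summable (\<lambda>k. of_nat (Suc k) powr (- s) :: complex)"
proof -
  have "norm (of_nat (Suc k) powr (- s) :: complex) = real (Suc k) powr (- Re s)" for k
    by (subst norm_powr_real_powr) auto
  moreover have "summable (\<lambda>k. real (Suc k) powr (- Re s))"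
    using assms by (subst summable_Suc_iff) (simp add: summable_real_powr_iff)
  ultimately show ?thesis by (intro summable_norm_cancel[where f = "\<lambda>k. of_nat (Suc k) powr (- s) :: complex"]) presburger
qed

text \<open>The function \<open>(s - 1) \<zeta>(s)\<close>, which has no pole.\<close>

definition zeta_aux :: "complex \<Rightarrow> complex" where
  "zeta_aux s = (s - 1) * (\<Sum>k. of_nat (Suc k) powr (- s))"

text \<open>The last factor of \<open>falling (1 - s) (Suc j)\<close> is \<open>1 - s - j\<close>,
  which is what turns zeta at \<open>s + j\<close> into \<open>- zeta_aux (s + j)\<close>. So the
  poles cancel and the coefficients are polynomials in \<open>s\<close>. The telescoping part
  contributes the 1, and \<open>zeta_aux s\<close> itself has coefficient 1, so that the identity
  can be solved for it.\<close>

lemma zeta_aux_recursion: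
  assumes s: "Re s > 1"
  shows "(\<Sum>j<n. falling (1 - s) j / fact (Suc j) * zeta_aux (s + of_nat j)) = 1 + (\<Sum>k. zrem n s (Suc k))"
proof -
  have "(\<lambda>k. norm (of_nat (Suc k) powr (1 - s) :: complex)) \<longlonglongrightarrow> 0"
  proof -
    have "norm (of_nat (Suc k) powr (1 - s) :: complex) = real (Suc k) powr (1 - Re s)" for k
      by (subst norm_powr_real_powr) auto
    moreover have "(\<lambda>k. real (Suc k) powr (1 - Re s)) \<longlonglongrightarrow> 0"
      using s by real_asymp
    ultimately show ?thesis by simp
  qed
  then have "(\<lambda>k. of_nat (Suc k) powr (1 - s) :: complex) \<longlonglongrightarrow> 0" by (rule tendsto_norm_zero_cancel)
  from telescope_sums[OF this]
  have tel: "(\<lambda>k. of_nat (Suc (Suc k)) powr (1 - s) - of_nat (Suc k) powr (1 - s) :: complex) sums (- 1)"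
    by simp
  have z: "(\<lambda>k. falling (1 - s) (Suc j) / fact (Suc j) * of_nat (Suc k) powr (1 - s - of_nat (Suc j))) sums
     (- (falling (1 - s) j / fact (Suc j) * zeta_aux (s + of_nat j)))" for j
  proof -
    have "summable (\<lambda>k. of_nat (Suc k) powr (- (s + of_nat j)) :: complex)"
      using s by (intro powr_neg_sums) simp
    from sums_mult[OF summable_sums[OF this], of "falling (1 - s) (Suc j) / fact (Suc j)"]
    have "(\<lambda>k. falling (1 - s) (Suc j) / fact (Suc j) * of_nat (Suc k) powr (- (s + of_nat j))) sums
       (falling (1 - s) (Suc j) / fact (Suc j) * (\<Sum>k. of_nat (Suc k) powr (- (s + of_nat j))))" .
    note A = this
    have e1: "- (s + of_nat j) = 1 - s - of_nat (Suc j)" by simp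
    have "falling (1 - s) (Suc j) = - falling (1 - s) j * (s + of_nat j - 1)"
      by (simp add: falling_def algebra_simps)
    then have e2: "falling (1 - s) (Suc j) / fact (Suc j) * (\<Sum>k. of_nat (Suc k) powr (- (s + of_nat j))) =
        - (falling (1 - s) j / fact (Suc j) * zeta_aux (s + of_nat j))"
      unfolding zeta_aux_def by (simp only: mult.assoc mult_minus_left minus_divide_left[symmetric] times_divide_eq_left)
    show ?thesis using A unfolding e2 unfolding e1 .
  qed
  have "(\<lambda>k. zrem n s (Suc k)) sums (- 1 - (\<Sum>j<n. - (falling (1 - s) j / fact (Suc j) * zeta_aux (s + of_nat j))))"
  proof -
    have "zrem n s (Suc k) = of_nat (Suc (Suc k)) powr (1 - s) - of_nat (Suc k) powr (1 - s) -
       (\<Sum>j<n. falling (1 - s) (Suc j) / fact (Suc j) * of_nat (Suc k) powr (1 - s - of_nat (Suc j)))" for k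
      unfolding zrem_def lessThan_Suc_atMost[symmetric] sum.lessThan_Suc_shift
      by (simp add: falling_def)
    then have eq: "(\<lambda>k. zrem n s (Suc k)) = (\<lambda>k. of_nat (Suc (Suc k)) powr (1 - s) - of_nat (Suc k) powr (1 - s) -
       (\<Sum>j<n. falling (1 - s) (Suc j) / fact (Suc j) * of_nat (Suc k) powr (1 - s - of_nat (Suc j))))"
      by (rule ext)
    show ?thesis unfolding eq by (intro sums_diff tel sums_sum z)
  qed
  then have "(\<Sum>k. zrem n s (Suc k)) = - 1 - (\<Sum>j<n. - (falling (1 - s) j / fact (Suc j) * zeta_aux (s + of_nat j)))"
    by (rule sums_unique[symmetric])
  then show ?thesis by (simp add: sum_negf)
qed

text \<open>The recursion expresses \<open>zeta_aux s\<close> by its values at \<open>s + 1\<close>,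
  \<open>s + 2\<close>, ... and a remainder. A shift by at least 1 lands in the half-plane already
  reached, and one more Taylor term makes the remainder holomorphic one unit further to the
  left.\<close>

lemma zeta_aux_continuation_halfplane:
  "\<exists>Z. Z holomorphic_on {s. Re s > 1 - real (Suc n)} \<and> (\<forall>s. Re s > 1 \<longrightarrow> Z s = zeta_aux s)"
proof (induction n)
  case 0
  have "(\<lambda>s. 1 + (\<Sum>k. zrem (Suc 0) s (Suc k))) holomorphic_on {s. Re s > 1 - real (Suc 0)}"
    by (intro holomorphic_intros holomorphic_zrem_sum)
  moreover have "1 + (\<Sum>k. zrem (Suc 0) s (Suc k)) = zeta_aux s" if "Re s > 1" for s
    using zeta_aux_recursion[OF that, of "Suc 0"] by (simp add: falling_def)
  ultimately show ?case by blast
next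
  case (Suc n)
  then obtain Z where Z: "Z holomorphic_on {s. Re s > 1 - real (Suc n)}" "\<And>s. Re s > 1 \<Longrightarrow> Z s = zeta_aux s"
    by blast
  define Y where "Y s = 1 + (\<Sum>k. zrem (Suc (Suc n)) s (Suc k)) -
      (\<Sum>j<Suc n. falling (1 - s) (Suc j) / fact (Suc (Suc j)) * Z (s + of_nat (Suc j)))" for s
  have "(\<lambda>s. Z (s + of_nat (Suc j))) holomorphic_on {s. Re s > 1 - real (Suc (Suc n))}" for j
    by (rule holomorphic_on_compose_gen[OF _ Z(1), unfolded o_def]) (auto intro!: holomorphic_intros)
  then have "Y holomorphic_on {s. Re s > 1 - real (Suc (Suc n))}"
    unfolding Y_def by (intro holomorphic_intros holomorphic_zrem_sum) auto
  moreover have "Y s = zeta_aux s" if "Re s > 1" for s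
  proof -
    have "(\<Sum>j<Suc n. falling (1 - s) (Suc j) / fact (Suc (Suc j)) * Z (s + of_nat (Suc j))) = 
      (\<Sum>j<Suc n. falling (1 - s) (Suc j) / fact (Suc (Suc j)) * zeta_aux (s + of_nat (Suc j)))"
      using that by (intro sum.cong refl arg_cong2[of _ _ _ _ "(*)"] Z(2)) simp
    moreover have "zeta_aux s + (\<Sum>j<Suc n. falling (1 - s) (Suc j) / fact (Suc (Suc j)) * zeta_aux (s + of_nat (Suc j))) =
        1 + (\<Sum>k. zrem (Suc (Suc n)) s (Suc k))"
      unfolding zeta_aux_recursion[OF that, symmetric] sum.lessThan_Suc_shift[of _ "Suc n"] by (simp add: falling_def)
    ultimately show ?thesis unfolding Y_def by (simp add: algebra_simps)
  qed
  ultimately show ?case by blast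
qed

lemma halfplane_continuation_unique:
  assumes "f holomorphic_on {s. Re s > c}" "g holomorphic_on {s. Re s > c}"
    and "\<And>s. Re s > b \<Longrightarrow> f s = g s" "c \<le> b" "Re z > c"
  shows "f z = g z"
proof (rule analytic_continuation_open[of "{s. Re s > b}" "{s. Re s > c}" f g z])
  have "of_real (b + 1) \<in> {s. Re s > b}" by simp
  then show "{s. Re s > b} \<noteq> {}" by blast
qed (use assms in \<open>auto intro: open_halfspace_Re_gt convex_connected convex_halfspace_Re_gt\<close>)

lemma zeta_aux_entire:
  "\<exists>Z. Z holomorphic_on UNIV \<and> (\<forall>s. Re s > 1 \<longrightarrow> Z s = zeta_aux s)"
proof -
  obtain Zf where Zf: "\<And>n. Zf n holomorphic_on {s. Re s > 1 - real (Suc n)}" 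
    "\<And>n s. Re s > 1 \<Longrightarrow> Zf n s = zeta_aux s"
    using zeta_aux_continuation_halfplane by metis
  \<comment> \<open>For this index \<open>m\<close> one has \<open>- m <= Re s - 1\<close>, so
    \<open>s\<close> lies in the domain of \<open>Zf m\<close>. By uniqueness, every other
    half-plane containing \<open>s\<close> gives the same value.\<close>
  define E where "E s = Zf (nat \<lceil>1 - Re s\<rceil>) s" for s
  have EZ: "E s = Zf n s" if "Re s > 1 - real (Suc n)" for n s
  proof -
    define m where "m = nat \<lceil>1 - Re s\<rceil>"
    have m: "Re s > 1 - real (Suc m)" unfolding m_def by (simp add: of_nat_nat) linarith
    have "Zf m s = Zf n s"
      by (rule halfplane_continuation_unique[of _ "max (1 - real (Suc n)) (1 - real (Suc m))" _ 1])
        (use that m in \<open>auto simp: Zf intro: holomorphic_on_subset[OF Zf(1)]\<close>)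
    then show ?thesis unfolding E_def m_def .
  qed
  have "E holomorphic_on (\<Union>n. {s. Re s > 1 - real (Suc n)})"
  proof (rule holomorphic_on_UN_open)
    fix n
    show "E holomorphic_on {s. Re s > 1 - real (Suc n)}"
      using Zf(1)[of n] by (rule holomorphic_transform) (simp only: EZ mem_Collect_eq)
  qed (simp add: open_halfspace_Re_gt)
  moreover have "(\<Union>n. {s. Re s > 1 - real (Suc n)}) = UNIV"
  proof (rule UNIV_eq_I[symmetric])
    fix s :: complex
    obtain n :: nat where "- Re s < n" using reals_Archimedean2 by blast
    then show "s \<in> (\<Union>n. {s. Re s > 1 - real (Suc n)})" by (intro UN_I[of n]) auto
  qed
  moreover have "E s = zeta_aux s" if "Re s > 1" for s
    using EZ[of 0 s] Zf(2)[OF that] that by simp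
  ultimately show ?thesis by auto
qed

section \<open>Zeta and its derivative at 0\<close>

text \<open>Existence of the limit is assumed; only its value is computed. In
  \<open>2 * a n - a (2 * n)\<close> the factorials combine to the Wallis product
  \<open>W n\<close>, while the limit of that expression is \<open>2 * L - L\<close>. The usual
  constant \<open>ln (2 * pi) / 2\<close> is lowered by 1 because the logarithm is taken at
  \<open>n + 1\<close> instead of \<open>n\<close>, which also keeps the sequence meaningful at
  0.\<close>

lemma stirling_constant:
  assumes "(\<lambda>n. ln (fact n) - (real n + 1 / 2) * ln (real n + 1) + real n) \<longlonglongrightarrow> L"
  shows "L = ln (2 * pi) / 2 - 1"
proof -
  define a where "a n = ln (fact n) - (real n + 1 / 2) * ln (real n + 1) + real n" for n
  define W where "W n = (\<Prod>k=1..n. (4*real k^2) / (4*real k^2 - 1))" for n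
  have W: "W n = 2 ^ (4 * n) * fact n ^ 4 / (fact (2 * n) ^ 2 * (2 * real n + 1))" for n
  proof (induction n)
    case 0
    then show ?case by (simp add: W_def)
  next
    case (Suc n)
    have nz: "2 * real n + 1 \<noteq> 0" "2 * real n + 3 \<noteq> 0" "real n + 1 \<noteq> 0" "(fact n::real) \<noteq> 0" "(fact (2 * n) :: real) \<noteq> 0"
      using of_nat_0_le_iff[of n, where 'a = real] by linarith+ auto
    have "W (Suc n) = W n * ((4 * real (Suc n) ^ 2) / (4 * real (Suc n) ^ 2 - 1))"
      by (simp add: W_def)
    also have "4 * real (Suc n) ^ 2 - 1 = (2 * real n + 1) * (2 * real n + 3)"
      by (simp add: power2_eq_square algebra_simps)
    finally have 1: "W (Suc n) = W n * (4 * (real n + 1) ^ 2) / ((2 * real n + 1) * (2 * real n + 3))"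
      by (simp add: add.commute)
    have 2: "fact (2 * Suc n) = (2 * real n + 2) * (2 * real n + 1) * fact (2 * n)"
      by (simp add: algebra_simps)
    have 3: "fact (Suc n) = (real n + 1) * fact n" by (simp add: algebra_simps)
    have 4: "2 * real (Suc n) + 1 = 2 * real n + 3" by simp
    have 5: "(2 :: real) ^ (4 * Suc n) = 16 * 2 ^ (4 * n)" by (simp add: power_add)
    have 6: "2 * real n + 2 = 2 * (real n + 1)" by simp
    have "P * f ^ 4 / (g ^ 2 * A) * (4 * N ^ 2) / (A * B) = 16 * P * (N * f) ^ 4 / ((2 * N * A * g) ^ 2 * B)"
      if "g \<noteq> 0" "A \<noteq> 0" "B \<noteq> 0" "N \<noteq> 0" for P f g A B N :: real
      using that by (simp add: divide_simps power2_eq_square power4_eq_xxxx)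
    from this[OF nz(5,1,2,3)] show ?case unfolding 1 2 3 4 5 6 Suc by simp
  qed
  have Wpos: "W n > 0" for n unfolding W by (intro divide_pos_pos mult_pos_pos) auto
  have "2 * a n - a (2 * n) = ln (W n) / 2 + ((2 * real n + 1) * (ln (2 * real n + 1) - ln (real n + 1)) - 2 * real n * ln 2)" for n
  proof -
    have "ln (W n) = 4 * real n * ln 2 + 4 * ln (fact n) - (2 * ln (fact (2 * n)) + ln (2 * real n + 1))"
      unfolding W by (simp add: ln_div ln_mult ln_realpow)
    then show ?thesis by (simp add: a_def algebra_simps)
  qed
  moreover have "(\<lambda>n. (2 * real n + 1) * (ln (2 * real n + 1) - ln (real n + 1)) - 2 * real n * ln 2) \<longlonglongrightarrow> ln 2 - 1"
    by real_asymp
  moreover have "(\<lambda>n. ln (W n) / 2) \<longlonglongrightarrow> ln (pi / 2) / 2"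
    using wallis unfolding W_def[symmetric] by (intro tendsto_intros) auto
  ultimately have "(\<lambda>n. 2 * a n - a (2 * n)) \<longlonglongrightarrow> ln (pi / 2) / 2 + (ln 2 - 1)"
    by (simp only:) (intro tendsto_add)
  moreover have "(\<lambda>n. 2 * a n - a (2 * n)) \<longlonglongrightarrow> 2 * L - L"
  proof -
    have a: "a \<longlonglongrightarrow> L" using assms by (simp add: a_def[abs_def])
    have "filterlim (\<lambda>n. 2 * n :: nat) sequentially sequentially"
      by (intro filterlim_subseq) (auto simp: strict_mono_def)
    from filterlim_compose[OF a this] a show ?thesis by (intro tendsto_intros)
  qed
  ultimately have "2 * L - L = ln (pi / 2) / 2 + (ln 2 - 1)" using LIMSEQ_unique by blast
  then show ?thesis by (simp add: ln_div ln_mult field_simps)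
qed

text \<open>The recursion with two Taylor terms is valid around 0 and involves
  \<open>Z (s + 1)\<close>, which the recursion with one term supplies around 1. At these two points
  the function expanded is linear or constant, so the remainders \<open>T 2 0\<close> and
  \<open>T 1 1\<close> vanish; their derivatives in \<open>s\<close> do not, and they carry the
  logarithms.\<close>

lemma zeta_aux_at_0:
  assumes Z: "Z holomorphic_on UNIV" "\<And>s. Re s > 1 \<Longrightarrow> Z s = zeta_aux s"
  shows "Z 0 = 1 / 2" "deriv Z 0 = of_real (ln (2 * pi) / 2 - 1 / 2)"
proof -
  define T where "T n s = (\<Sum>k. zrem n s (Suc k))" for n s
  have T_hol: "T n holomorphic_on {s. Re s > 1 - real n}" for n
    unfolding T_def by (rule holomorphic_zrem_sum)
  have T1_hol: "(\<lambda>s. T 1 (s + 1)) holomorphic_on {s. Re s > - 1}"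
    by (rule holomorphic_on_compose_gen[OF _ T_hol, unfolded o_def]) (auto intro!: holomorphic_intros)
  have ZT: "Z s = 1 - (1 - s) / 2 * (1 + T 1 (s + 1)) + T 2 s" if "Re s > - 1" for s
  proof (rule halfplane_continuation_unique[of Z "-1" _ 1])
    show "Z holomorphic_on {s. Re s > - 1}" using Z(1) by (rule holomorphic_on_subset) simp
    show "(\<lambda>s. 1 - (1 - s) / 2 * (1 + T 1 (s + 1)) + T 2 s) holomorphic_on {s. Re s > - 1}"
      using T_hol[of 2] by (intro holomorphic_intros T1_hol) auto
    fix s :: complex assume s: "Re s > 1"
    have "zeta_aux (s + 1) = 1 + T 1 (s + 1)"
      using zeta_aux_recursion[of "s + 1" 1] s by (simp add: falling_def T_def)
    moreover have "zeta_aux s + (1 - s) / 2 * zeta_aux (s + 1) = 1 + T 2 s"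
      using zeta_aux_recursion[OF s, of 2] by (simp add: falling_def T_def numeral_2_eq_2)
    ultimately show "Z s = 1 - (1 - s) / 2 * (1 + T 1 (s + 1)) + T 2 s"
      using Z(2)[OF s] by (simp add: algebra_simps)
  qed (use that in auto)
  have z1: "zrem 1 s k = of_nat (Suc k) powr (1 - s) - of_nat k powr (1 - s) - (1 - s) * of_nat k powr (- s)" for s k
    by (simp add: zrem_def falling_def)
  have z2: "zrem 2 s k = of_nat (Suc k) powr (1 - s) - of_nat k powr (1 - s) - (1 - s) * of_nat k powr (- s)
      + (1 - s) * s / 2 * of_nat k powr (- 1 - s)" for s k
    by (simp add: zrem_def falling_def numeral_2_eq_2 algebra_simps add_divide_distrib diff_divide_distrib)
  have "zrem 1 1 (Suc k) = 0" for k
    unfolding z1 by (simp del: of_nat_Suc)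
  then have T10: "T 1 1 = 0" unfolding T_def by simp
  have "zrem 2 0 (Suc k) = 0" for k
  proof -
    have "zrem 2 0 (Suc k) = of_nat (Suc (Suc k)) - of_nat (Suc k) - 1"
      unfolding z2 by (simp del: of_nat_Suc)
    then show ?thesis by simp
  qed
  then have T20: "T 2 0 = 0" unfolding T_def by simp
  show "Z 0 = 1 / 2" using ZT[of 0] T10 T20 by simp
  \<comment> \<open>\<open>D1 k\<close> and \<open>D2 k\<close> are the derivatives in
    \<open>s\<close> of \<open>zrem 1 s k\<close> at 1 and of \<open>zrem 2 s k\<close> at
    0.\<close>
  define D1 where "D1 k = - ln (real (Suc k)) + ln (real k) + 1 / real k" for k
  define D2 where "D2 k = - real (Suc k) * ln (real (Suc k)) + real k * ln (real k) + 1 + ln (real k) + 1 / (2 * real k)" for k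
  have p: "((\<lambda>s. of_nat k powr (c - s)) has_field_derivative - of_real (ln (real k)) * of_nat k powr (c - s)) (at s)"
    if "k > 0" for k and c s :: complex
  proof -
    have "((\<lambda>z. of_nat k powr z :: complex) has_field_derivative Ln (of_nat k) * of_nat k powr (c - s)) (at (c - s))"
      using that by (intro has_field_derivative_powr_right) auto
    moreover have "((\<lambda>s. c - s) has_field_derivative - 1) (at s)" by (auto intro!: derivative_eq_intros)
    ultimately show ?thesis using that DERIV_chain2 by (fastforce simp: Ln_of_nat)
  qed
  have d1: "((\<lambda>s. zrem 1 s k) has_field_derivative of_real (D1 k)) (at 1)" if "k > 0" for k
  proof -
    have "((\<lambda>s::complex. of_nat (Suc k) powr (1 - s) - of_nat k powr (1 - s) - (1 - s) * of_nat k powr (0 - s)) 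
      has_field_derivative of_real (D1 k)) (at 1)"
      by (rule DERIV_cong[OF DERIV_diff[OF DERIV_diff[OF p p] DERIV_mult[OF DERIV_diff[OF DERIV_const DERIV_ident] p]]])
        (use that in \<open>simp_all add: D1_def powr_minus field_simps del: of_nat_Suc\<close>)
    then show ?thesis unfolding z1 by simp
  qed
  have q: "((\<lambda>s::complex. (1 - s) * s / 2) has_field_derivative 1 / 2) (at 0)"
    by (auto intro!: derivative_eq_intros)
  have d2: "((\<lambda>s. zrem 2 s k) has_field_derivative of_real (D2 k)) (at 0)" if "k > 0" for k
  proof -
    have "((\<lambda>s::complex. of_nat (Suc k) powr (1 - s) - of_nat k powr (1 - s) - (1 - s) * of_nat k powr (0 - s)
        + (1 - s) * s / 2 * of_nat k powr (- 1 - s)) has_field_derivative of_real (D2 k)) (at 0)"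
      by (rule DERIV_cong[OF DERIV_add[OF DERIV_diff[OF DERIV_diff[OF p p] DERIV_mult[OF DERIV_diff[OF DERIV_const DERIV_ident] p]]
          DERIV_mult[OF q p]]])
        (use that in \<open>simp_all add: D2_def powr_minus field_simps del: of_nat_Suc\<close>)
    then show ?thesis unfolding z2 by simp
  qed
  \<comment> \<open>Locally uniform convergence of holomorphic functions passes to derivatives, so
    the remainder series may be differentiated term by term.\<close>
  have lim: "(\<lambda>N. \<Sum>k<N. D (Suc k)) \<longlonglongrightarrow> deriv (T n) s"
    if sn: "Re s > 1 - real n" and der: "\<And>k. k > 0 \<Longrightarrow> ((\<lambda>s. zrem n s k) has_field_derivative D k) (at s)" for n s D
  proof -
    obtain d where d: "d > 0" "cball s d \<subseteq> {s. Re s > 1 - real n}"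
      "uniform_limit (cball s d) (\<lambda>N s. \<Sum>k<N. zrem n s (Suc k)) (T n) sequentially"
      using zrem_uniform_limit[OF sn] unfolding T_def[abs_def] by blast
    have "(\<lambda>N. deriv (\<lambda>s. \<Sum>k<N. zrem n s (Suc k)) s) \<longlonglongrightarrow> deriv (T n) s"
    proof (rule deriv_complex_uniform_limit)
      show "uniform_limit (ball s d) (\<lambda>N s. \<Sum>k<N. zrem n s (Suc k)) (T n) sequentially"
        using d(3) by (rule uniform_limit_on_subset) auto
      show "\<forall>\<^sub>F N in sequentially. (\<lambda>s. \<Sum>k<N. zrem n s (Suc k)) holomorphic_on ball s d"
        unfolding zrem_def by (intro always_eventually allI holomorphic_intros) auto
    qed (use d in auto)
    moreover have "deriv (\<lambda>s. \<Sum>k<N. zrem n s (Suc k)) s = (\<Sum>k<N. D (Suc k))" for N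
      by (intro DERIV_imp_deriv DERIV_sum der) auto
    ultimately show ?thesis by simp
  qed
  have L1: "(\<lambda>N. \<Sum>k<N. of_real (D1 (Suc k))) \<longlonglongrightarrow> deriv (T 1) 1"
    by (rule lim[of 1 1 "\<lambda>k. of_real (D1 k)"]) (use d1 in auto)
  have L2: "(\<lambda>N. \<Sum>k<N. of_real (D2 (Suc k))) \<longlonglongrightarrow> deriv (T 2) 0"
    by (rule lim[of 2 0 "\<lambda>k. of_real (D2 k)"]) (use d2 in auto)
  have "(T 1 has_field_derivative deriv (T 1) 1) (at 1)"
    using T_hol[of 1] by (rule holomorphic_derivI) (auto simp: open_halfspace_Re_gt)
  then have "((\<lambda>s. T 1 (s + 1)) has_field_derivative deriv (T 1) 1) (at 0)"
    using DERIV_shift[of "T 1" _ 0 1] by simp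
  moreover have "(T 2 has_field_derivative deriv (T 2) 0) (at 0)"
    using T_hol[of 2] by (rule holomorphic_derivI) (auto simp: open_halfspace_Re_gt)
  ultimately have "((\<lambda>s. 1 - (1 - s) / 2 * (1 + T 1 (s + 1)) + T 2 s) has_field_derivative
      (1 / 2 - deriv (T 1) 1 / 2 + deriv (T 2) 0)) (at 0)"
    by (auto intro!: derivative_eq_intros simp: T10[simplified] field_simps)
  then have "(Z has_field_derivative (1 / 2 - deriv (T 1) 1 / 2 + deriv (T 2) 0)) (at 0)"
    by (rule has_field_derivative_transform_within_open[of _ _ _ "{s. Re s > - 1}"])
      (auto simp: open_halfspace_Re_gt ZT)
  then have dZ: "deriv Z 0 = 1 / 2 - deriv (T 1) 1 / 2 + deriv (T 2) 0" by (rule DERIV_imp_deriv)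
  define a where "a N = ln (fact N) - (real N + 1 / 2) * ln (real N + 1) + real N" for N
  have L: "(\<lambda>N. 1 / 2 - (\<Sum>k<N. of_real (D1 (Suc k))) / 2 + (\<Sum>k<N. of_real (D2 (Suc k)))) \<longlonglongrightarrow> deriv Z 0"
    unfolding dZ by (intro tendsto_intros L1 L2) auto
  have "1 / 2 - (\<Sum>k<N. D1 (Suc k)) / 2 + (\<Sum>k<N. D2 (Suc k)) = 1 / 2 + a N" for N
  proof (induction N)
    case 0
    then show ?case by (simp add: a_def)
  next
    case (Suc N)
    \<comment> \<open>This combination of the two remainder derivatives is an increment of the
      Stirling sequence, so the partial sums telescope. Convergence of the series provides the
      existence of the limit that \<open>stirling_constant\<close> assumes.\<close>
    have eqD: "D2 (Suc N) - D1 (Suc N) / 2 = a (Suc N) - a N"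
    proof -
      define x where "x = real (Suc N)"
      have "ln (fact (Suc N) :: real) = ln x + ln (fact N)"
        by (simp add: ln_mult x_def)
      then have "a (Suc N) = ln x + ln (fact N) - (x + 1 / 2) * ln (x + 1) + x"
        by (simp only: a_def x_def)
      moreover have "a N = ln (fact N) - (x - 1 / 2) * ln x + (x - 1)"
        by (simp add: a_def x_def add.commute)
      moreover have "D1 (Suc N) = - ln (x + 1) + ln x + 1 / x"
        by (simp add: D1_def x_def add_ac)
      moreover have "D2 (Suc N) = - (x + 1) * ln (x + 1) + x * ln x + 1 + ln x + 1 / x / 2"
        by (simp add: D2_def x_def add_ac)
      ultimately show ?thesis
        by (simp only:) (simp add: algebra_simps add_divide_distrib diff_divide_distrib)
    qed
    have gen: "1 / 2 - (S1 + d1) / 2 + (S2 + d2) = 1 / 2 + y"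
      if "d2 - d1 / 2 = y - x" "1 / 2 - S1 / 2 + S2 = 1 / 2 + x" for S1 S2 d1 d2 x y :: real
      using that by argo
    show ?case unfolding sum.lessThan_Suc by (rule gen[OF eqD Suc.IH])
  qed
  note sum_eq = this
  have seq: "1 / 2 - (\<Sum>k<N. of_real (D1 (Suc k))) / 2 + (\<Sum>k<N. of_real (D2 (Suc k))) = complex_of_real (1 / 2 + a N)" for N
    unfolding sum_eq[symmetric] by simp
  from L have A: "(\<lambda>N. complex_of_real (1 / 2 + a N)) \<longlonglongrightarrow> deriv Z 0" unfolding seq .
  have "(\<lambda>N. 1 / 2 + a N) \<longlonglongrightarrow> Re (deriv Z 0)" using tendsto_Re[OF A] by simp
  from tendsto_diff[OF this tendsto_const[of "1 / 2"]] have "a \<longlonglongrightarrow> Re (deriv Z 0) - 1 / 2" by simp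
  then have "Re (deriv Z 0) - 1 / 2 = ln (2 * pi) / 2 - 1" unfolding a_def[abs_def] by (rule stirling_constant)
  then have R: "Re (deriv Z 0) = ln (2 * pi) / 2 - 1 / 2" by simp
  have "Im (deriv Z 0) = 0" using tendsto_Im[OF A] by (simp add: LIMSEQ_const_iff)
  then show "deriv Z 0 = of_real (ln (2 * pi) / 2 - 1 / 2)" using R by (simp add: complex_eq_iff)
qed

subsection \<open>Complex embeddings of a number field\<close>

lemma embedding_add: "\<sigma> \<in> embeddings \<Longrightarrow> \<sigma> (x + y) = \<sigma> x + \<sigma> y"
  and embedding_mult: "\<sigma> \<in> embeddings \<Longrightarrow> \<sigma> (x * y) = \<sigma> x * \<sigma> y"
  and embedding_1: "\<sigma> \<in> embeddings \<Longrightarrow> \<sigma> 1 = 1"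
  by (auto simp: embeddings_def)

lemma embedding_0: "\<sigma> \<in> embeddings \<Longrightarrow> \<sigma> 0 = 0"
proof -
  assume "\<sigma> \<in> embeddings"
  from embedding_add[OF this, of 0 0] show ?thesis by simp
qed

lemma embedding_of_rat:
  assumes \<sigma>: "\<sigma> \<in> embeddings"
  shows "\<sigma> (of_rat q) = of_rat q"
proof -
  have nat: "\<sigma> (of_nat n) = of_nat n" for n
    by (induction n) (simp_all add: embedding_0[OF \<sigma>] embedding_1[OF \<sigma>] embedding_add[OF \<sigma>])
  have neg: "\<sigma> (- x) = - \<sigma> x" for x
    using embedding_add[OF \<sigma>, of x "- x"] embedding_0[OF \<sigma>] by (simp add: minus_unique)
  have int: "\<sigma> (of_int m) = of_int m" for m
    by (cases m rule: int_cases2) (simp_all only: of_int_minus of_int_of_nat_eq nat neg)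
  obtain a b where q: "q = Rat.Fract a b" "b > 0" by (cases q) (use that in blast)
  have "of_rat q * of_int b = (of_int a :: 'a)" using q by (simp add: of_rat_rat)
  then have "\<sigma> (of_rat q * of_int b) = \<sigma> (of_int a)" by (rule arg_cong)
  then have "\<sigma> (of_rat q) * of_int b = of_int a"
    unfolding embedding_mult[OF \<sigma>] int .
  then have "\<sigma> (of_rat q) = of_int a / of_int b" using q(2) by (simp add: eq_divide_eq)
  then show ?thesis using q by (simp add: of_rat_rat)
qed

lemma embedding_sum: "\<sigma> \<in> embeddings \<Longrightarrow> \<sigma> (sum f A) = (\<Sum>x\<in>A. \<sigma> (f x))"
  by (induction A rule: infinite_finite_induct) (simp_all add: embedding_0 embedding_add)

lemma embedding_power: "\<sigma> \<in> embeddings \<Longrightarrow> \<sigma> (x ^ n) = \<sigma> x ^ n"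
  by (induction n) (simp_all add: embedding_1 embedding_mult)

section \<open>Finiteness and existence of embeddings by linear algebra\<close>

definition rat_linear :: "('k::field_char_0 \<Rightarrow> complex) \<Rightarrow> bool" where
  "rat_linear f \<longleftrightarrow> (\<forall>x y. f (x + y) = f x + f y) \<and> (\<forall>q x. f (of_rat q * x) = of_rat q * f x)"

lemma rat_linear_sum:
  assumes "rat_linear f"
  shows "f (\<Sum>i\<in>A. of_rat (c i) * g i) = (\<Sum>i\<in>A. of_rat (c i) * f (g i))"
proof -
  have "f 0 = 0" using assms[unfolded rat_linear_def, THEN conjunct2, rule_format, of 0 0] by simp
  then show ?thesis using assms
    by (induction A rule: infinite_finite_induct) (auto simp: rat_linear_def)
qed

locale number_field_basis =
  fixes B :: "'k::field_char_0 set"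
  assumes fd: "finite_dimensional_vector_space (\<lambda>(q::rat) (x::'k). of_rat q * x) B"
begin

sublocale V: finite_dimensional_vector_space "\<lambda>(q::rat) (x::'k). of_rat q * x" B
  by (rule fd)

lemma rational_annihilator:
  "\<exists>p::rat poly. p \<noteq> 0 \<and> (\<Sum>i\<le>degree p. of_rat (coeff p i) * x ^ i) = (0::'k)"
proof -
  define N where "N = V.dim UNIV"
  have "\<exists>c::nat \<Rightarrow> rat. (\<exists>i\<le>N. c i \<noteq> 0) \<and> (\<Sum>i\<le>N. of_rat (c i) * x ^ i) = 0"
  \<comment> \<open>Linear dependence is a property of the set of powers, so coinciding powers are
    treated apart: they give the annihilator \<open>X ^ i - X ^ j\<close>.\<close>
  proof (cases "inj_on (\<lambda>i. x ^ i) {..N}")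
    case True
    let ?S = "(\<lambda>i. x ^ i) ` {..N}"
    have "card ?S = Suc N" using True by (simp add: card_image)
    then have "V.dependent ?S"
      using V.independent_card_le_dim[of ?S UNIV] unfolding N_def by fastforce
    then obtain u where u: "\<exists>v\<in>?S. u v \<noteq> 0" "(\<Sum>v\<in>?S. of_rat (u v) * v) = 0"
      by (auto simp: V.dependent_finite)
    then show ?thesis
      by (intro exI[of _ "\<lambda>i. u (x ^ i)"]) (auto simp: sum.reindex[OF True])
  next
    case False
    then obtain i j where ij: "i \<le> N" "j \<le> N" "i \<noteq> j" "x ^ i = x ^ j" by (auto simp: inj_on_def)
    define c :: "nat \<Rightarrow> rat" where "c k = (if k = i then 1 else 0) - (if k = j then 1 else 0)" for k
    have "(\<Sum>k\<le>N. of_rat (c k) * x ^ k) = (\<Sum>k\<le>N. (if k = i then x ^ k else 0) - (if k = j then x ^ k else 0))"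
      by (intro sum.cong) (auto simp: c_def)
    also have "\<dots> = 0" using ij by (simp add: sum_subtractf)
    finally show ?thesis using ij by (intro exI[of _ c]) (auto simp: c_def)
  qed
  then obtain c :: "nat \<Rightarrow> rat" and i where c: "i \<le> N" "c i \<noteq> 0" "(\<Sum>i\<le>N. of_rat (c i) * x ^ i) = 0" by blast
  define p where "p = (\<Sum>i\<le>N. monom (c i) i)"
  have cp: "coeff p k = (if k \<le> N then c k else 0)" for k
    by (simp add: p_def coeff_sum)
  have "degree p \<le> N" by (intro degree_le) (simp add: cp)
  then have "(\<Sum>i\<le>degree p. of_rat (coeff p i) * x ^ i) = (\<Sum>i\<le>N. of_rat (coeff p i) * x ^ i)"
    by (intro sum.mono_neutral_left) (auto simp: coeff_eq_0)
  also have "\<dots> = 0" using c(3) by (simp add: cp)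
  finally show ?thesis using c(1,2) cp[of i] by (intro exI[of _ p]) auto
qed

text \<open>An embedding is determined by its values on the basis, and each value is a root of the
  fixed rational polynomial that annihilates the basis element.\<close>

lemma finite_embeddings: "finite (embeddings :: ('k \<Rightarrow> complex) set)"
proof -
  obtain p :: "'k \<Rightarrow> rat poly" where p: "\<And>x. p x \<noteq> 0" "\<And>x. (\<Sum>i\<le>degree (p x). of_rat (coeff (p x) i) * x ^ i) = 0"
    using rational_annihilator by metis
  define R where "R x = {z::complex. poly (map_poly of_rat (p x)) z = 0}" for x
  have finR: "finite (R x)" for x
    unfolding R_def by (intro poly_roots_finite) (use p in \<open>simp add: poly_eq_iff coeff_map_poly\<close>)
  have "restrict \<sigma> B \<in> PiE B R" if \<sigma>: "\<sigma> \<in> embeddings" for \<sigma>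
  proof -
    have "\<sigma> b \<in> R b" for b
    proof -
      have "0 = \<sigma> (\<Sum>i\<le>degree (p b). of_rat (coeff (p b) i) * b ^ i)"
        by (simp add: p embedding_0[OF \<sigma>])
      also have "\<dots> = (\<Sum>i\<le>degree (p b). of_rat (coeff (p b) i) * \<sigma> b ^ i)"
        by (simp add: embedding_sum[OF \<sigma>] embedding_mult[OF \<sigma>] embedding_of_rat[OF \<sigma>] embedding_power[OF \<sigma>])
      finally show ?thesis by (simp add: R_def poly_altdef coeff_map_poly degree_map_poly)
    qed
    then show ?thesis by auto
  qed
  then have "(\<lambda>\<sigma>. restrict \<sigma> B) ` embeddings \<subseteq> PiE B R" by blast
  then have "finite ((\<lambda>\<sigma>. restrict \<sigma> B) ` (embeddings :: ('k \<Rightarrow> complex) set))"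
    by (rule finite_subset) (intro finite_PiE V.finite_Basis finR)
  moreover have "inj_on (\<lambda>\<sigma>. restrict \<sigma> B) (embeddings :: ('k \<Rightarrow> complex) set)"
  proof (rule inj_onI)
    fix \<sigma> \<tau> :: "'k \<Rightarrow> complex" assume st: "\<sigma> \<in> embeddings" "\<tau> \<in> embeddings" "restrict \<sigma> B = restrict \<tau> B"
    have "V.span B \<subseteq> {x. \<sigma> x = \<tau> x}"
    proof (rule V.span_minimal)
      show "B \<subseteq> {x. \<sigma> x = \<tau> x}" using st(3) by (auto simp: restrict_def fun_eq_iff split: if_splits)
      show "V.subspace {x. \<sigma> x = \<tau> x}"
        unfolding V.subspace_def using st(1,2) by (auto simp: embedding_0 embedding_add embedding_mult embedding_of_rat)
    qed
    then show "\<sigma> = \<tau>" by (auto simp: V.span_Basis)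
  qed
  ultimately show ?thesis by (rule finite_imageD)
qed

lemma rat_linear_nonzero_exists: "\<exists>f::'k \<Rightarrow> complex. rat_linear f \<and> (\<exists>y. f y \<noteq> 0)"
proof -
  have "(1::'k) \<in> V.span B" by (simp add: V.span_Basis)
  then have "B \<noteq> {}" by auto
  then obtain b where b: "b \<in> B" by blast
  define f :: "'k \<Rightarrow> complex" where "f x = of_rat (V.representation B x b)" for x
  have "rat_linear f"
    unfolding rat_linear_def f_def
    by (auto simp: V.representation_add V.representation_scale V.independent_Basis V.span_Basis of_rat_add of_rat_mult)
  moreover have "f b \<noteq> 0" using b by (simp add: f_def V.representation_basis V.independent_Basis)
  ultimately show ?thesis by blast
qed

text \<open>Multiplication by elements of \<open>S\<close> acts on the rational-linear forms \<open>'k \<Rightarrow> complex\<close>; a common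
  eigenvector for a whole basis yields an embedding as its eigenvalue character.\<close>

lemma common_eigenform:
  assumes "finite S"
  shows "\<exists>f::'k \<Rightarrow> complex. rat_linear f \<and> (\<exists>y. f y \<noteq> 0) \<and> (\<forall>b\<in>S. \<exists>c. \<forall>y. f (b * y) = c * f y)"
  using assms
proof (induction S rule: finite_induct)
  case empty
  show ?case using rat_linear_nonzero_exists by simp
next
  case (insert b S)
  obtain f :: "'k \<Rightarrow> complex" where F: "rat_linear f \<and> (\<exists>y. f y \<noteq> 0) \<and> (\<forall>b\<in>S. \<exists>c. \<forall>y. f (b * y) = c * f y)"
    using insert.IH by (rule exE)
  note f = F[THEN conjunct1] F[THEN conjunct2, THEN conjunct1] F[THEN conjunct2, THEN conjunct2, rule_format]
  \<comment> \<open>\<open>act q\<close> is the form \<open>f\<close> precomposed with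
    multiplication by \<open>q(b)\<close>, written out because \<open>q\<close> has complex
    coefficients while \<open>b\<close> lies in the field.\<close>
  define act where "act q y = (\<Sum>i\<le>degree q. coeff q i * f (b ^ i * y))" for q :: "complex poly" and y
  have act_eq: "act q y = (\<Sum>i\<le>n. coeff q i * f (b ^ i * y))" if "degree q \<le> n" for q y n
    unfolding act_def using that by (intro sum.mono_neutral_left) (auto simp: coeff_eq_0)
  obtain p :: "rat poly" where p: "p \<noteq> 0" "(\<Sum>i\<le>degree p. of_rat (coeff p i) * b ^ i) = 0"
    using rational_annihilator by blast
  have "act (map_poly of_rat p) y = 0" for y
  proof -
    have "act (map_poly of_rat p) y = f (\<Sum>i\<le>degree p. of_rat (coeff p i) * (b ^ i * y))"
      unfolding rat_linear_sum[OF f(1)] by (simp add: act_def coeff_map_poly degree_map_poly)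
    also have "(\<Sum>i\<le>degree p. of_rat (coeff p i) * (b ^ i * y)) = (\<Sum>i\<le>degree p. of_rat (coeff p i) * b ^ i) * y"
      by (simp add: sum_distrib_right mult.assoc)
    also have "f \<dots> = 0" using rat_linear_sum[OF f(1), of _ _ "{}"] by (simp add: p)
    finally show ?thesis .
  qed
  moreover have "map_poly of_rat p \<noteq> (0 :: complex poly)" using p by (simp add: poly_eq_iff coeff_map_poly)
  ultimately have "\<exists>q. q \<noteq> 0 \<and> (\<forall>y. act q y = 0)" by blast
  \<comment> \<open>\<open>q\<close> plays the role of the minimal polynomial of multiplication by
    \<open>b\<close> on \<open>f\<close>. With a root \<open>c\<close> and
    \<open>q = (X - c) * r\<close>, minimality makes \<open>act r\<close> nonzero, and it is the
    eigenform sought.\<close>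
  from ex_has_least_nat[of "\<lambda>q. q \<noteq> 0 \<and> (\<forall>y. act q y = 0)", OF someI_ex[OF this], of degree]
  obtain q where q: "q \<noteq> 0" "\<And>y. act q y = 0"
    and least: "\<And>r. r \<noteq> 0 \<Longrightarrow> (\<forall>y. act r y = 0) \<Longrightarrow> degree q \<le> degree r"
    by blast
  have "degree q \<noteq> 0"
  proof
    assume "degree q = 0"
    then obtain a where "q = [:a:]" by (rule degree_eq_zeroE)
    then show False using q f(2) by (auto simp: act_def)
  qed
  then have "\<not> constant (poly q)" by (simp add: constant_degree)
  then obtain c where "poly q c = 0" using Fundamental_Theorem_Algebra.fundamental_theorem_of_algebra by blast
  then obtain r where r: "q = [:- c, 1:] * r" by (auto simp: poly_eq_0_iff_dvd)
  have r0: "r \<noteq> 0" using q(1) r by auto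
  then have "degree r < degree q" unfolding r by (subst degree_mult_eq) auto
  then obtain y0 where y0: "act r y0 \<noteq> 0" using least[OF r0] by (meson not_less)
  \<comment> \<open>That \<open>(X - c) * r\<close> acts as zero says exactly that multiplication by
    \<open>b\<close> scales \<open>act r\<close> by \<open>c\<close>. The eigenvalues for
    \<open>S\<close> persist because multiplications commute.\<close>
  have "act r (b * y) = c * act r y" for y
  proof -
    have "0 = act q y" by (simp add: q)
    also have "act q y = (\<Sum>i\<le>Suc (degree r). coeff (pCons 0 r - smult c r) i * f (b ^ i * y))"
    proof -
      have "q = pCons 0 r - smult c r" unfolding r by simp
      moreover have "degree q \<le> Suc (degree r)" unfolding r by (rule order_trans[OF degree_mult_le]) simp
      ultimately show ?thesis by (simp only: act_eq)
    qed
    also have "\<dots> = (\<Sum>i\<le>Suc (degree r). coeff (pCons 0 r) i * f (b ^ i * y)) - 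
        c * (\<Sum>i\<le>Suc (degree r). coeff r i * f (b ^ i * y))"
      by (simp only: coeff_diff coeff_smult left_diff_distrib sum_subtractf sum_distrib_left mult.assoc)
    also have "(\<Sum>i\<le>Suc (degree r). coeff r i * f (b ^ i * y)) = act r y"
      by (rule act_eq[symmetric]) simp
    also have "(\<Sum>i\<le>Suc (degree r). coeff (pCons 0 r) i * f (b ^ i * y)) = act r (b * y)"
      by (simp only: sum.atMost_Suc_shift coeff_pCons_Suc coeff_pCons_0 act_def power_Suc2 mult.assoc) simp
    finally show ?thesis by simp
  qed
  moreover have "\<exists>c. \<forall>y. act r (s * y) = c * act r y" if s: "s \<in> S" for s
  proof -
    obtain c where c: "\<And>y. f (s * y) = c * f y" using f(3)[OF s] by blast
    have "f (b ^ i * (s * y)) = c * f (b ^ i * y)" for i y using c[of "b ^ i * y"] by (simp add: mult_ac)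
    then show ?thesis
      by (intro exI[of _ c] allI) (simp only: act_def sum_distrib_left mult.left_commute[of c])
  qed
  moreover have "rat_linear (act r)"
    unfolding rat_linear_def
  proof (intro conjI allI)
    fix x y
    have "f (b ^ i * (x + y)) = f (b ^ i * x) + f (b ^ i * y)" for i
      using f(1) unfolding rat_linear_def distrib_left by blast
    then show "act r (x + y) = act r x + act r y"
      by (simp only: act_def distrib_left sum.distrib)
  next
    fix q x
    have "f (b ^ i * (of_rat q * x)) = of_rat q * f (b ^ i * x)" for i
      using f(1) unfolding rat_linear_def mult.left_commute[of _ "of_rat q"] by blast
    then show "act r (of_rat q * x) = of_rat q * act r x"
      by (simp only: act_def sum_distrib_left mult.left_commute[of _ "of_rat q"])
  qed
  ultimately show ?case using y0 by (intro exI[of _ "act r"]) auto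
qed

text \<open>The elements whose multiplication scales \<open>f\<close> form a rational subspace, so
  scaling on \<open>B\<close> extends to the whole field. Evaluation at a point \<open>y0\<close>
  with \<open>f y0\<close> nonzero shows that the scaling factor is additive and
  multiplicative.\<close>

lemma embeddings_nonempty: "(embeddings :: ('k \<Rightarrow> complex) set) \<noteq> {}"
proof -
  obtain f :: "'k \<Rightarrow> complex" where F: "rat_linear f \<and> (\<exists>y. f y \<noteq> 0) \<and> (\<forall>b\<in>B. \<exists>c. \<forall>y. f (b * y) = c * f y)"
    using common_eigenform[OF V.finite_Basis] by (rule exE)
  obtain y0 where y0: "f y0 \<noteq> 0" using F[THEN conjunct2, THEN conjunct1] by (rule exE)
  note f = F[THEN conjunct1] y0 F[THEN conjunct2, THEN conjunct2, rule_format]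
  have "V.span B \<subseteq> {x. \<exists>c. \<forall>y. f (x * y) = c * f y}"
  proof (rule V.span_minimal)
    show "V.subspace {x. \<exists>c. \<forall>y. f (x * y) = c * f y}"
      unfolding V.subspace_def
    proof (intro conjI ballI allI)
      have "f 0 = 0" using rat_linear_sum[OF f(1), of _ _ "{}"] by simp
      then show "0 \<in> {x. \<exists>c. \<forall>y. f (x * y) = c * f y}" by (auto intro: exI[of _ 0])
    next
      fix x x' assume "x \<in> {x. \<exists>c. \<forall>y. f (x * y) = c * f y}" "x' \<in> {x. \<exists>c. \<forall>y. f (x * y) = c * f y}"
      then obtain c c' where "\<And>y. f (x * y) = c * f y" "\<And>y. f (x' * y) = c' * f y" by blast
      then have "f ((x + x') * y) = (c + c') * f y" for y
        using f(1) unfolding rat_linear_def distrib_right by metis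
      then show "x + x' \<in> {x. \<exists>c. \<forall>y. f (x * y) = c * f y}" by blast
    next
      fix q x assume "x \<in> {x. \<exists>c. \<forall>y. f (x * y) = c * f y}"
      then obtain c where "\<And>y. f (x * y) = c * f y" by blast
      then have "f (of_rat q * x * y) = of_rat q * c * f y" for y
        using f(1) unfolding rat_linear_def mult.assoc by metis
      then show "of_rat q * x \<in> {x. \<exists>c. \<forall>y. f (x * y) = c * f y}" by blast
    qed
    show "B \<subseteq> {x. \<exists>c. \<forall>y. f (x * y) = c * f y}"
      by (intro subsetI CollectI f(3))
  qed
  then have "\<exists>c. \<forall>y. f (x * y) = c * f y" for x unfolding V.span_Basis by blast
  then have "\<exists>\<sigma>. \<forall>x y. f (x * y) = \<sigma> x * f y" by (intro choice allI)
  then obtain \<sigma> where \<sigma>: "\<And>x y. f (x * y) = \<sigma> x * f y" by blast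
  have "\<sigma> \<in> embeddings" unfolding embeddings_def mem_Collect_eq
  proof (intro conjI allI)
    have "\<sigma> 1 * f y0 = 1 * f y0" unfolding \<sigma>[symmetric] by simp
    then show "\<sigma> 1 = 1" using f(2) mult_right_cancel by blast
    fix x y
    have "\<sigma> (x + y) * f y0 = (\<sigma> x + \<sigma> y) * f y0"
      unfolding distrib_right \<sigma>[symmetric] using f(1) by (simp only: rat_linear_def)
    then show "\<sigma> (x + y) = \<sigma> x + \<sigma> y" using f(2) mult_right_cancel by blast
    have "\<sigma> (x * y) * f y0 = \<sigma> x * \<sigma> y * f y0"
      unfolding mult.assoc \<sigma>[symmetric] ..
    then show "\<sigma> (x * y) = \<sigma> x * \<sigma> y" using f(2) mult_right_cancel by blast
  qed
  then show ?thesis by blast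
qed

end

lemma places_eq_image:
  "real_places = (\<lambda>\<sigma>. {\<sigma>, cnj \<circ> \<sigma>}) ` {\<sigma> \<in> embeddings. range \<sigma> \<subseteq> \<real>}"
  "complex_places = (\<lambda>\<sigma>. {\<sigma>, cnj \<circ> \<sigma>}) ` {\<sigma> \<in> embeddings. \<not> range \<sigma> \<subseteq> \<real>}"
  unfolding real_places_def complex_places_def by (rule setcompr_eq_image)+

lemma number_field_embeddings:
  assumes "number_field TYPE('k::field_char_0)"
  shows "finite (embeddings :: ('k \<Rightarrow> complex) set)" "(embeddings :: ('k \<Rightarrow> complex) set) \<noteq> {}"
proof -
  obtain B where "finite_dimensional_vector_space (\<lambda>(q::rat) (x::'k). of_rat q * x) B"
    using assms unfolding number_field_def by (rule exE)
  then interpret number_field_basis B by (rule number_field_basis.intro)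
  show "finite (embeddings :: ('k \<Rightarrow> complex) set)" "(embeddings :: ('k \<Rightarrow> complex) set) \<noteq> {}"
    by (rule finite_embeddings embeddings_nonempty)+
qed

text \<open>One embedding is not enough: \<open>card\<close> of an infinite set is 0, so finiteness
  of the set of embeddings enters as well.\<close>

lemma r1_plus_r2_pos:
  assumes "number_field TYPE('k::field_char_0)"
  shows "r1 TYPE('k) + r2 TYPE('k) > 0"
proof -
  note emb = number_field_embeddings[OF assms]
  obtain \<sigma> :: "'k \<Rightarrow> complex" where \<sigma>: "\<sigma> \<in> embeddings" using emb(2) by blast
  show ?thesis
  proof (cases "range \<sigma> \<subseteq> \<real>")
    case True
    then have "card ((\<lambda>\<sigma>. {\<sigma>, cnj \<circ> \<sigma>}) ` {\<sigma> \<in> (embeddings :: ('k \<Rightarrow> complex) set). range \<sigma> \<subseteq> \<real>}) > 0"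
      unfolding card_gt_0_iff image_is_empty using \<sigma> emb(1) by (intro conjI finite_imageI) auto
    then show ?thesis unfolding r1_def places_eq_image by (rule trans_less_add1)
  next
    case False
    then have "card ((\<lambda>\<sigma>. {\<sigma>, cnj \<circ> \<sigma>}) ` {\<sigma> \<in> (embeddings :: ('k \<Rightarrow> complex) set). \<not> range \<sigma> \<subseteq> \<real>}) > 0"
      unfolding card_gt_0_iff image_is_empty using \<sigma> emb(1) by (intro conjI finite_imageI) auto
    then show ?thesis unfolding r2_def places_eq_image by (rule trans_less_add2)
  qed
qed

lemma r2_eq_0_iff_totally_real:
  assumes "number_field TYPE('k::field_char_0)"
  shows "r2 TYPE('k) = 0 \<longleftrightarrow> totally_real TYPE('k)"
proof -
  have "finite ((\<lambda>\<sigma>. {\<sigma>, cnj \<circ> \<sigma>}) ` {\<sigma> \<in> (embeddings :: ('k \<Rightarrow> complex) set). \<not> range \<sigma> \<subseteq> \<real>})"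
    using number_field_embeddings(1)[OF assms] by (intro finite_imageI) simp
  then have "r2 TYPE('k) = 0 \<longleftrightarrow> {\<sigma> \<in> (embeddings :: ('k \<Rightarrow> complex) set). \<not> range \<sigma> \<subseteq> \<real>} = {}"
    unfolding r2_def places_eq_image by (simp only: card_0_eq image_is_empty)
  also have "\<dots> \<longleftrightarrow> totally_real TYPE('k)"
    unfolding totally_real_def Collect_empty_eq Ball_def not_not de_Morgan_conj imp_conv_disj ..
  finally show ?thesis .
qed

subsection \<open>Transcendence of pi\<close>

lemma Rats_fact [simp]: "(fact n :: 'a::field_char_0) \<in> \<rat>"
  by (metis Rats_of_nat of_nat_fact)

section \<open>Power sums and subset sums through formal power series\<close>

text \<open>Lists keep the multiplicity of coinciding subset sums. The identity is applied to
  exponentials both of power series and of complex numbers.\<close>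

lemma prod_list_one_plus_subseqs:
  fixes f :: "'a \<Rightarrow> 'b::comm_semiring_1"
  shows "(\<Prod>x\<leftarrow>xs. 1 + f x) = (\<Sum>ys\<leftarrow>subseqs xs. \<Prod>y\<leftarrow>ys. f y)"
proof (induction xs)
  case Nil
  then show ?case by simp
next
  case (Cons a xs)
  have "(\<Sum>ys\<leftarrow>subseqs (a # xs). \<Prod>y\<leftarrow>ys. f y) = 
      f a * (\<Sum>ys\<leftarrow>subseqs xs. \<Prod>y\<leftarrow>ys. f y) + (\<Sum>ys\<leftarrow>subseqs xs. \<Prod>y\<leftarrow>ys. f y)"
    by (simp add: Let_def o_def sum_list_const_mult)
  then show ?case using Cons by (simp add: algebra_simps)
qed

text \<open>Coefficient \<open>n\<close> of \<open>Q * P\<close> determines that of \<open>P\<close>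
  from the earlier ones, at the sole cost of inverting the constant term of \<open>Q\<close>. A
  general \<open>R\<close> covers both the rationals and the integers.\<close>

lemma fps_coeffs_quotient:
  fixes P Q :: "'a::field fps"
  assumes R: "\<And>x y. x \<in> R \<Longrightarrow> y \<in> R \<Longrightarrow> x + y \<in> R" "\<And>x y. x \<in> R \<Longrightarrow> y \<in> R \<Longrightarrow> x * y \<in> R"
    "\<And>x. x \<in> R \<Longrightarrow> - x \<in> R" "0 \<in> R"
  and Q: "\<And>n. fps_nth Q n \<in> R" "fps_nth Q 0 \<noteq> 0" "inverse (fps_nth Q 0) \<in> R"
  and QP: "\<And>n. fps_nth (Q * P) n \<in> R"
  shows "fps_nth P n \<in> R"
proof (induction n rule: less_induct)
  case (less n)
  have sumR: "sum f A \<in> R" if "\<And>x. x \<in> A \<Longrightarrow> f x \<in> R" for f and A :: "nat set"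
    using that by (induction A rule: infinite_finite_induct) (auto simp: R)
  have "fps_nth (Q * P) n = fps_nth Q 0 * fps_nth P n + (\<Sum>i=1..n. fps_nth Q i * fps_nth P (n - i))"
    by (simp add: fps_mult_nth sum.atLeast_Suc_atMost)
  then have eq: "fps_nth P n = inverse (fps_nth Q 0) *
      (fps_nth (Q * P) n + - (\<Sum>i=1..n. fps_nth Q i * fps_nth P (n - i)))"
    using Q(2) by (simp add: field_simps)
  have "(\<Sum>i=1..n. fps_nth Q i * fps_nth P (n - i)) \<in> R"
    by (rule sumR) (auto intro!: R(2) Q less)
  then show ?case unfolding eq by (intro R Q QP)
qed

text \<open>Comparing coefficients determines \<open>Suc m * F (Suc m)\<close> from earlier ones;
  the division by \<open>Suc m\<close> is why this is about rationals and not about a general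
  subring.\<close>

lemma fps_rational_ODE:
  fixes F U :: "'a::field_char_0 fps"
  assumes "fps_deriv F = F * U" "fps_nth F 0 \<in> \<rat>" "\<And>n. fps_nth U n \<in> \<rat>"
  shows "fps_nth F n \<in> \<rat>"
proof (induction n rule: less_induct)
  case (less n)
  show ?case
  proof (cases n)
    case 0
    then show ?thesis using assms by simp
  next
    case (Suc m)
    have "of_nat (Suc m) * fps_nth F (Suc m) = (\<Sum>i=0..m. fps_nth F i * fps_nth U (m - i))"
      using arg_cong[OF assms(1), of "\<lambda>F. fps_nth F m"] by (simp add: fps_mult_nth)
    then have eq: "fps_nth F n = (\<Sum>i=0..m. fps_nth F i * fps_nth U (m - i)) / of_nat (Suc m)"
      by (simp add: Suc field_simps del: of_nat_Suc)
    show ?thesis unfolding eq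
      by (intro Rats_divide Rats_sum Rats_mult less assms) (auto simp: Suc)
  qed
qed

text \<open>Newton's identities packed into a logarithmic derivative:
  \<open>- x / (1 - x * t)\<close> has the coefficients \<open>- (x ^ Suc k)\<close>.\<close>

lemma fps_deriv_prod_list_one_minus:
  fixes xs :: "'a::field_char_0 list"
  shows "fps_deriv (\<Prod>x\<leftarrow>xs. 1 - fps_const x * fps_X) =
    (\<Prod>x\<leftarrow>xs. 1 - fps_const x * fps_X) * Abs_fps (\<lambda>k. - (\<Sum>x\<leftarrow>xs. x ^ Suc k))"
proof (induction xs)
  case Nil
  have "Abs_fps (\<lambda>k. - (\<Sum>x\<leftarrow>[]. x ^ Suc k)) = (0::'a fps)" by (rule fps_ext) simp
  then show ?case by simp
next
  case (Cons a xs)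
  let ?Q = "\<Prod>x\<leftarrow>xs. 1 - fps_const x * fps_X"
  let ?P = "Abs_fps (\<lambda>k. - (\<Sum>x\<leftarrow>xs. x ^ Suc k))"
  have 1: "(1 - fps_const a * fps_X) * Abs_fps (\<lambda>k. - (a ^ Suc k)) = - fps_const a"
  proof (rule fps_ext)
    fix n show "fps_nth ((1 - fps_const a * fps_X) * Abs_fps (\<lambda>k. - (a ^ Suc k))) n = fps_nth (- fps_const a) n"
      by (cases n) (simp_all add: algebra_simps fps_X_mult_nth)
  qed
  have 2: "Abs_fps (\<lambda>k. - (\<Sum>x\<leftarrow>a # xs. x ^ Suc k)) = Abs_fps (\<lambda>k. - (a ^ Suc k)) + ?P"
    by (rule fps_ext) simp
  have "fps_deriv (\<Prod>x\<leftarrow>a # xs. 1 - fps_const x * fps_X) =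
     - fps_const a * ?Q + (1 - fps_const a * fps_X) * (?Q * ?P)"
    by (simp add: Cons)
  also have "\<dots> = (1 - fps_const a * fps_X) * ?Q * (Abs_fps (\<lambda>k. - (a ^ Suc k)) + ?P)"
    unfolding 1[symmetric] by (simp add: algebra_simps)
  finally show ?case unfolding 2 unfolding list.map prod_list.Cons .
qed

text \<open>The logarithmic derivative of \<open>1 + fps_exp x\<close> is
  \<open>x * u(x * t)\<close>, whose coefficient \<open>k\<close> depends on \<open>x\<close> only
  through \<open>x ^ Suc k\<close>. Over the whole list nothing but power sums appears.\<close>

lemma fps_deriv_prod_list_one_plus_exp:
  fixes xs :: "'a::field_char_0 list"
  defines "u \<equiv> fps_exp 1 * inverse (1 + fps_exp (1::'a))"
  shows "fps_deriv (\<Prod>x\<leftarrow>xs. 1 + fps_exp x) =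
    (\<Prod>x\<leftarrow>xs. 1 + fps_exp x) * Abs_fps (\<lambda>k. fps_nth u k * (\<Sum>x\<leftarrow>xs. x ^ Suc k))"
proof (induction xs)
  case Nil
  have "Abs_fps (\<lambda>k. fps_nth u k * (\<Sum>x\<leftarrow>[]. x ^ Suc k)) = (0::'a fps)" by (rule fps_ext) simp
  then show ?case by simp
next
  case (Cons a xs)
  let ?Q = "\<Prod>x\<leftarrow>xs. 1 + fps_exp x"
  let ?P = "Abs_fps (\<lambda>k. fps_nth u k * (\<Sum>x\<leftarrow>xs. x ^ Suc k))"
  let ?S = "Abs_fps (\<lambda>k. fps_nth u k * a ^ Suc k)"
  have S: "?S = fps_const a * (u oo (fps_const a * fps_X))"
    by (rule fps_ext) (simp add: fps_nth_compose_linear)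
  have u: "(1 + fps_exp 1) * u = fps_exp 1"
    by (simp add: u_def mult.left_commute inverse_mult_eq_1')
  have "(1 + fps_exp a) * (u oo (fps_const a * fps_X)) = (((1 + fps_exp 1) * u) oo (fps_const a * fps_X))"
    by (subst fps_compose_mult_distrib) (simp_all add: fps_compose_add_distrib)
  then have 1: "(1 + fps_exp a) * ?S = fps_const a * fps_exp a"
    unfolding S u by (simp add: mult.left_commute)
  have 2: "Abs_fps (\<lambda>k. fps_nth u k * (\<Sum>x\<leftarrow>a # xs. x ^ Suc k)) = ?S + ?P"
    by (rule fps_ext) (simp add: algebra_simps)
  have "fps_deriv (\<Prod>x\<leftarrow>a # xs. 1 + fps_exp x) =
     fps_const a * fps_exp a * ?Q + (1 + fps_exp a) * (?Q * ?P)"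
    by (simp add: Cons)
  also have "\<dots> = (1 + fps_exp a) * ?Q * (?S + ?P)"
    unfolding 1[symmetric] by (simp add: algebra_simps)
  finally show ?case unfolding 2 unfolding list.map prod_list.Cons .
qed

text \<open>The product has constant term 1, so solving Newton's identities for the power sums
  creates no denominators.\<close>

lemma power_sum_in_subring:
  fixes xs :: "'a::field_char_0 list"
  assumes R: "\<And>x y. x \<in> R \<Longrightarrow> y \<in> R \<Longrightarrow> x + y \<in> R" "\<And>x y. x \<in> R \<Longrightarrow> y \<in> R \<Longrightarrow> x * y \<in> R"
    "\<And>x. x \<in> R \<Longrightarrow> - x \<in> R" "0 \<in> R" "1 \<in> R"
  and Q: "\<And>n. fps_nth (\<Prod>x\<leftarrow>xs. 1 - fps_const x * fps_X) n \<in> R"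
  shows "(\<Sum>x\<leftarrow>xs. x ^ Suc n) \<in> R"
proof -
  let ?Q = "\<Prod>x\<leftarrow>xs. 1 - fps_const x * fps_X"
  have Q0: "fps_nth ?Q 0 = 1" by (induction xs) auto
  have nat: "of_nat n \<in> R" for n by (induction n) (auto simp: R)
  have "fps_nth (Abs_fps (\<lambda>k. - (\<Sum>x\<leftarrow>xs. x ^ Suc k))) n \<in> R"
  proof (rule fps_coeffs_quotient[where Q = ?Q])
    fix n
    have "of_nat (Suc n) * fps_nth ?Q (Suc n) \<in> R" by (intro R Q nat)
    then show "fps_nth (?Q * Abs_fps (\<lambda>k. - (\<Sum>x\<leftarrow>xs. x ^ Suc k))) n \<in> R"
      unfolding fps_deriv_prod_list_one_minus[symmetric] by simp
  qed (use R Q Q0 in simp_all)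
  from R(3)[OF this] show ?thesis by simp
qed

text \<open>Replaces the fundamental theorem of symmetric polynomials: the logarithmic derivative of
  \<open>\<Prod>(1 + exp (x * t))\<close> is rational because the power sums of the \<open>x\<close> are, and the Taylor coefficients
  of that product are the power sums of the subset sums.\<close>

lemma prod_one_minus_subset_sums_rational:
  fixes xs :: "'a::field_char_0 list"
  assumes "\<And>n. fps_nth (\<Prod>x\<leftarrow>xs. 1 - fps_const x * fps_X) n \<in> \<rat>"
  shows "fps_nth (\<Prod>y\<leftarrow>map sum_list (subseqs xs). 1 - fps_const y * fps_X) n \<in> \<rat>"
proof -
  let ?u = "fps_exp 1 * inverse (1 + fps_exp (1::'a))"
  let ?F = "\<Prod>x\<leftarrow>xs. 1 + fps_exp x"
  have u: "fps_nth ?u n \<in> \<rat>" for n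
  proof (rule fps_coeffs_quotient[where Q = "1 + fps_exp 1"])
    fix n
    show "fps_nth (1 + fps_exp (1::'a)) n \<in> \<rat>"
      by (cases n) (auto intro!: Rats_add Rats_divide Rats_fact)
    have eq: "(1 + fps_exp (1::'a)) * ?u = fps_exp 1"
      by (simp add: mult.left_commute inverse_mult_eq_1')
    show "fps_nth ((1 + fps_exp 1) * ?u) n \<in> \<rat>" unfolding eq by (auto intro!: Rats_divide Rats_fact)
  qed auto
  have F0: "fps_nth ?F 0 \<in> \<rat>" by (induction xs) auto
  have F: "fps_nth ?F n \<in> \<rat>" for n
    by (rule fps_rational_ODE[OF fps_deriv_prod_list_one_plus_exp])
      (auto intro!: F0 Rats_mult u power_sum_in_subring assms simp del: power_Suc)
  have "(\<Prod>y\<leftarrow>ys. fps_exp y) = fps_exp (sum_list ys :: 'a)" for ys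
    by (induction ys) (auto simp: fps_exp_add_mult)
  then have FS: "?F = (\<Sum>y\<leftarrow>map sum_list (subseqs xs). fps_exp y)"
    by (simp add: prod_list_one_plus_subseqs o_def)
  have nth: "fps_nth (\<Sum>y\<leftarrow>ys. fps_exp y) n = (\<Sum>y\<leftarrow>ys. y ^ n) / fact n" for ys :: "'a list" and n
    by (induction ys) (auto simp: add_divide_distrib)
  have pow: "(\<Sum>y\<leftarrow>map sum_list (subseqs xs). y ^ n) \<in> \<rat>" for n
  proof -
    have "(\<Sum>y\<leftarrow>map sum_list (subseqs xs). y ^ n) = fact n * fps_nth ?F n"
      unfolding FS nth by simp
    also have "\<dots> \<in> \<rat>" by (metis F Rats_mult Rats_of_nat of_nat_fact)
    finally show ?thesis .
  qed
  have Q0: "fps_nth (\<Prod>x\<leftarrow>ys. 1 - fps_const x * fps_X) 0 = (1::'a)" for ys by (induction ys) auto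
  \<comment> \<open>Newton's identities in the other direction: the power sums of the subset sums
    determine the product, with denominators that are harmless over the rationals.\<close>
  show ?thesis
    by (rule fps_rational_ODE[OF fps_deriv_prod_list_one_minus])
      (use pow Q0 in \<open>auto simp del: power_Suc map_map\<close>)
qed

section \<open>Hermite's method for sums of exponentials\<close>

text \<open>Hermite's transform: the value at \<open>x\<close> of the sum of all derivatives of \<open>f\<close>.\<close>

definition hermite :: "complex poly \<Rightarrow> complex \<Rightarrow> complex" where
  "hermite f x = (\<Sum>m\<le>degree f. coeff f m * (\<Sum>r\<le>m. fact r * of_nat (m choose r) * x ^ (m - r)))"

lemma coeff_pcompose_shift:
  fixes f :: "complex poly"
  shows "coeff (pcompose f [:x, 1:]) r = (\<Sum>m\<le>degree f. coeff f m * (of_nat (m choose r) * x ^ (m - r)))"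
proof -
  have "pcompose f [:x, 1:] = (\<Sum>m\<le>degree f. smult (coeff f m) ([:x, 1:] ^ m))"
    by (simp add: pcompose_altdef poly_altdef coeff_map_poly degree_map_poly)
  moreover have "coeff ([:x, 1:] ^ m) r = of_nat (m choose r) * x ^ (m - r)" for m
  proof (cases "r \<le> m")
    case True
    then show ?thesis by (simp add: coeff_linear_poly_power)
  next
    case False
    then show ?thesis by (simp add: coeff_eq_0 degree_power_eq)
  qed
  ultimately show ?thesis by (simp add: coeff_sum)
qed

text \<open>\<open>fact r * coeff (pcompose f [:x, 1:]) r\<close> is derivative number
  \<open>r\<close> of \<open>f\<close> at \<open>x\<close>. This form displays the factorials on
  which the divisibility argument rests.\<close>

lemma hermite_altdef:
  "hermite f x = (\<Sum>r\<le>degree f. fact r * coeff (pcompose f [:x, 1:]) r)"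
proof -
  have "hermite f x = (\<Sum>m\<le>degree f. \<Sum>r\<le>degree f. coeff f m * (fact r * of_nat (m choose r) * x ^ (m - r)))"
    unfolding hermite_def sum_distrib_left
    by (intro sum.cong refl sum.mono_neutral_left) auto
  also have "\<dots> = (\<Sum>r\<le>degree f. fact r * coeff (pcompose f [:x, 1:]) r)"
    by (subst sum.swap) (simp add: coeff_pcompose_shift sum_distrib_left mult_ac)
  finally show ?thesis .
qed

text \<open>For a monomial the transform is \<open>fact m\<close> times the exponential series cut
  off after degree \<open>m\<close>, so the difference is a tail. Since
  \<open>fact m * fact (Suc j)\<close> divides \<open>fact (m + Suc j)\<close>, the tail is
  dominated by \<open>norm x ^ m\<close> times an exponential series.\<close>

lemma hermite_monomial_bound:
  fixes x :: complex
  shows "norm (fact m * exp x - (\<Sum>r\<le>m. fact r * of_nat (m choose r) * x ^ (m - r))) \<le> norm x ^ m * exp (norm x)"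
proof -
  have "(\<Sum>r\<le>m. fact r * of_nat (m choose r) * x ^ (m - r)) =
      (\<Sum>j\<le>m. fact (m - j) * of_nat (m choose j) * x ^ j)"
    unfolding atMost_atLeast0 by (subst sum.atLeastAtMost_rev) (auto intro!: sum.cong simp: binomial_symmetric[symmetric])
  also have "\<dots> = (\<Sum>j<Suc m. fact m * (x ^ j /\<^sub>R fact j))"
    unfolding lessThan_Suc_atMost
    by (intro sum.cong refl) (simp add: binomial_fact scaleR_conv_of_real field_simps)
  also have "\<dots> = fact m * (\<Sum>j<Suc m. x ^ j /\<^sub>R fact j)"
    by (simp only: sum_distrib_left)
  finally have 1: "(\<Sum>r\<le>m. fact r * of_nat (m choose r) * x ^ (m - r)) = fact m * (\<Sum>j<Suc m. x ^ j /\<^sub>R fact j)" .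
  have "exp x = (\<Sum>j. x ^ (j + Suc m) /\<^sub>R fact (j + Suc m)) + (\<Sum>j<Suc m. x ^ j /\<^sub>R fact j)"
    unfolding exp_def by (rule suminf_split_initial_segment) (rule summable_exp_generic)
  then have 2: "fact m * exp x - (\<Sum>r\<le>m. fact r * of_nat (m choose r) * x ^ (m - r)) =
     fact m * (\<Sum>j. x ^ (j + Suc m) /\<^sub>R fact (j + Suc m))"
    unfolding 1 by (simp add: algebra_simps)
  have s: "summable (\<lambda>j. norm (x ^ (j + Suc m) /\<^sub>R fact (j + Suc m)))"
    using summable_norm_exp[of x] by (subst summable_iff_shift) auto
  have s2: "summable (\<lambda>j. norm x ^ m * (norm x ^ Suc j /\<^sub>R fact (Suc j)))"
    using summable_exp_generic[of "norm x"] by (intro summable_mult) (subst summable_Suc_iff)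
  have "norm (fact m * (\<Sum>j. x ^ (j + Suc m) /\<^sub>R fact (j + Suc m))) \<le> 
      fact m * (\<Sum>j. norm (x ^ (j + Suc m) /\<^sub>R fact (j + Suc m)))"
    unfolding norm_mult norm_fact by (intro mult_left_mono summable_norm s) simp
  also have "\<dots> = (\<Sum>j. fact m * norm (x ^ (j + Suc m) /\<^sub>R fact (j + Suc m)))"
    by (rule suminf_mult[OF s, symmetric])
  also have "\<dots> \<le> (\<Sum>j. norm x ^ m * (norm x ^ Suc j /\<^sub>R fact (Suc j)))"
  proof (rule suminf_le[OF _ summable_mult[OF s] s2])
    fix j
    have "fact m * fact (Suc j) \<le> (fact (m + Suc j) :: nat)"
      by (rule dvd_imp_le[OF fact_fact_dvd_fact]) simp
    then have "fact m * fact (Suc j) \<le> (fact (m + Suc j) :: real)"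
      by (metis of_nat_fact of_nat_le_iff of_nat_mult)
    moreover have eq: "j + Suc m = m + Suc j" by simp
    ultimately have "fact m / fact (j + Suc m) \<le> (1 / fact (Suc j) :: real)"
      unfolding eq by (simp add: pos_divide_le_eq pos_le_divide_eq del: fact_Suc add_Suc_right)
    then have "norm x ^ (m + Suc j) * (fact m / fact (j + Suc m)) \<le> norm x ^ (m + Suc j) * (1 / fact (Suc j) :: real)"
      by (intro mult_left_mono) auto
    then show "fact m * norm (x ^ (j + Suc m) /\<^sub>R fact (j + Suc m)) \<le> norm x ^ m * (norm x ^ Suc j /\<^sub>R fact (Suc j))"
      by (simp add: norm_power norm_mult power_add field_simps del: fact_Suc)
  qed
  also have "\<dots> = norm x ^ m * (\<Sum>j. norm x ^ Suc j /\<^sub>R fact (Suc j))"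
    using summable_exp_generic[of "norm x"] by (intro suminf_mult) (subst summable_Suc_iff)
  also have "(\<Sum>j. norm x ^ Suc j /\<^sub>R fact (Suc j)) \<le> exp (norm x)"
    using suminf_split_head[OF summable_exp_generic[of "norm x"]] by (simp add: exp_def)
  finally show ?thesis unfolding 2 by (simp add: mult_left_mono)
qed

text \<open>The difference is Hermite's integral of \<open>exp (x - u) * f u\<close> over
  \<open>u\<close> from 0 to \<open>x\<close>. It is estimated here monomial by monomial.\<close>

lemma hermite_bound:
  "norm (hermite f 0 * exp x - hermite f x) \<le> exp (norm x) * poly (map_poly norm f) (norm x)"
proof -
  have 0: "(\<Sum>r\<le>m. fact r * of_nat (m choose r) * 0 ^ (m - r)) = (fact m :: complex)" for m
    by (subst sum.remove[of _ m]) (auto intro!: sum.neutral)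
  have "hermite f 0 * exp x - hermite f x = 
     (\<Sum>m\<le>degree f. coeff f m * (fact m * exp x - (\<Sum>r\<le>m. fact r * of_nat (m choose r) * x ^ (m - r))))"
    unfolding hermite_def 0 by (simp add: sum_distrib_right sum_distrib_left sum_subtractf algebra_simps)
  also have "norm \<dots> \<le> (\<Sum>m\<le>degree f. norm (coeff f m) * (norm x ^ m * exp (norm x)))"
    by (intro sum_norm_le) (auto simp: norm_mult intro!: mult_left_mono hermite_monomial_bound)
  also have "\<dots> = exp (norm x) * poly (map_poly norm f) (norm x)"
    by (simp add: poly_altdef coeff_map_poly degree_map_poly sum_distrib_left mult_ac)
  finally show ?thesis .
qed

lemma poly_norm_mult_le:
  fixes f g :: "complex poly"
  assumes "t \<ge> 0"
  shows "poly (map_poly norm (f * g)) t \<le> poly (map_poly norm f) t * poly (map_poly norm g) t"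
proof -
  have mono: "poly p t \<le> poly q t" if "\<And>i. coeff p i \<le> coeff q i" for p q :: "real poly"
  proof -
    let ?n = "max (degree p) (degree q)"
    have "poly p t = (\<Sum>i\<le>?n. coeff p i * t ^ i)" "poly q t = (\<Sum>i\<le>?n. coeff q i * t ^ i)"
      unfolding poly_altdef by (auto intro!: sum.mono_neutral_left simp: le_degree)
    then show ?thesis using that assms by (auto intro!: sum_mono mult_right_mono)
  qed
  have "poly (map_poly norm (f * g)) t \<le> poly (map_poly norm f * map_poly norm g) t"
    by (rule mono) (auto simp: coeff_map_poly coeff_mult norm_mult intro!: sum_norm_le)
  then show ?thesis by simp
qed

lemma poly_norm_power_le:
  fixes f :: "complex poly"
  assumes "t \<ge> 0"
  shows "poly (map_poly norm (f ^ n)) t \<le> poly (map_poly norm f) t ^ n"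
proof (induction n)
  case 0
  then show ?case by (simp add: map_poly_1')
next
  case (Suc n)
  have nonneg: "0 \<le> poly (map_poly norm f) t"
    using assms by (simp add: poly_altdef coeff_map_poly sum_nonneg)
  have "poly (map_poly norm (f ^ Suc n)) t \<le> poly (map_poly norm f) t * poly (map_poly norm (f ^ n)) t"
    using poly_norm_mult_le[OF assms] by simp
  also have "\<dots> \<le> poly (map_poly norm f) t * poly (map_poly norm f) t ^ n"
    by (intro mult_left_mono Suc nonneg)
  finally show ?case by simp
qed

lemma coeff_pcompose_shift_root:
  fixes f :: "complex poly"
  assumes "[:- a, 1:] ^ p dvd f" "r < p"
  shows "coeff (pcompose f [:a, 1:]) r = 0"
proof -
  obtain g where g: "f = [:- a, 1:] ^ p * g" using assms(1) by (elim dvdE)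
  have pow: "pcompose (q ^ n) [:a, 1:] = pcompose q [:a, 1:] ^ n" for q n
    by (induction n) (simp_all add: pcompose_mult pcompose_1)
  have "pcompose f [:a, 1:] = monom 1 p * pcompose g [:a, 1:]"
    by (simp add: g pcompose_mult pow pcompose_pCons monom_altdef)
  then show ?thesis using assms(2) by (simp add: coeff_monom_mult)
qed

lemma sum_list_sum_swap:
  fixes g :: "'a \<Rightarrow> 'b \<Rightarrow> 'c::comm_monoid_add"
  shows "(\<Sum>x\<leftarrow>xs. \<Sum>m\<in>A. g m x) = (\<Sum>m\<in>A. \<Sum>x\<leftarrow>xs. g m x)"
  by (induction xs) (simp_all add: sum.distrib)

text \<open>A single shifted coefficient need not be integral, but the sum over \<open>xs\<close> is
  an integer combination of power sums with exponents at most \<open>N\<close>, whose denominators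
  \<open>c ^ N\<close> clears.\<close>

lemma sum_list_coeff_pcompose_shift_Ints:
  fixes f :: "complex poly"
  assumes f: "\<And>i. coeff f i \<in> \<int>" and pow: "\<And>n. c ^ n * (\<Sum>x\<leftarrow>xs. x ^ n) \<in> \<int>"
    and c: "c \<in> \<int>" and deg: "degree f \<le> N + r"
  shows "c ^ N * (\<Sum>x\<leftarrow>xs. coeff (pcompose f [:x, 1:]) r) \<in> \<int>"
proof -
  have "c ^ N * (\<Sum>x\<leftarrow>xs. coeff (pcompose f [:x, 1:]) r) =
     (\<Sum>m\<le>degree f. coeff f m * of_nat (m choose r) * (c ^ (N - (m - r)) * (c ^ (m - r) * (\<Sum>x\<leftarrow>xs. x ^ (m - r)))))"
    unfolding coeff_pcompose_shift sum_list_sum_swap sum_distrib_left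
  proof (rule sum.cong)
    fix m assume "m \<in> {..degree f}"
    then have "c ^ N = c ^ (N - (m - r)) * c ^ (m - r)"
      using deg by (simp add: power_add[symmetric])
    then show "c ^ N * (\<Sum>x\<leftarrow>xs. coeff f m * (of_nat (m choose r) * x ^ (m - r))) =
      coeff f m * of_nat (m choose r) * (c ^ (N - (m - r)) * (c ^ (m - r) * (\<Sum>x\<leftarrow>xs. x ^ (m - r))))"
      by (simp add: sum_list_const_mult)
  qed simp
  also have "\<dots> \<in> \<int>" by (intro Ints_sum Ints_mult f Ints_power c pow) auto
  finally show ?thesis .
qed

lemma sum_fact_multiple:
  fixes g :: "nat \<Rightarrow> 'a::field_char_0"
  assumes "\<And>r. r \<ge> p \<Longrightarrow> g r \<in> \<int>" and "\<And>r. r < p \<Longrightarrow> g r = 0"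
  shows "\<exists>z\<in>\<int>. (\<Sum>r\<le>n. fact r * g r) = fact p * z"
proof (induction n)
  case 0
  show ?case
  proof (cases "p = 0")
    case True
    then show ?thesis using assms(1)[of 0] by auto
  next
    case False
    then show ?thesis using assms(2)[of 0] by (intro bexI[of _ 0]) auto
  qed
next
  case (Suc n)
  then obtain z where z: "z \<in> \<int>" "(\<Sum>r\<le>n. fact r * g r) = fact p * z" by blast
  show ?case
  proof (cases "Suc n < p")
    case True
    then show ?thesis using z assms(2)[of "Suc n"] by auto
  next
    case False
    then have "(fact p :: nat) dvd fact (Suc n)" by (intro fact_dvd) simp
    then obtain k where "(fact (Suc n) :: nat) = fact p * k" by (elim dvdE)
    then have k: "(fact (Suc n) :: 'a) = fact p * of_nat k" by (metis of_nat_fact of_nat_mult)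
    have "g (Suc n) \<in> \<int>" using assms(1) False by simp
    then show ?thesis using z
      by (intro bexI[of _ "z + of_nat k * g (Suc n)"]) (auto simp: k algebra_simps simp del: fact_Suc)
  qed
qed

lemma coeff_mult_Ints:
  fixes p q :: "'a::comm_ring_1 poly"
  assumes "\<And>i. coeff p i \<in> \<int>" "\<And>i. coeff q i \<in> \<int>"
  shows "coeff (p * q) i \<in> \<int>"
  using assms by (auto simp: coeff_mult)

lemma coeff_power_Ints:
  fixes p :: "'a::comm_ring_1 poly"
  assumes "\<And>i. coeff p i \<in> \<int>"
  shows "coeff (p ^ n) i \<in> \<int>"
proof (induction n arbitrary: i)
  case 0
  then show ?case by (cases i) auto
next
  case (Suc n)
  then show ?case using assms by (auto intro!: coeff_mult_Ints)
qed

text \<open>\<open>f\<close> vanishes to order at least \<open>p\<close> at each \<open>x\<close>,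
  so those terms yield a multiple of \<open>fact p\<close>. At 0 its order is exactly
  \<open>p - 1\<close>, which leaves \<open>fact (p - 1) * t ^ p\<close>. Divided by
  \<open>fact (p - 1)\<close>, the expression is an integer congruent to
  \<open>k * c ^ (M * p) * t ^ p\<close> modulo \<open>p\<close>, hence nonzero for a prime
  \<open>p\<close> beyond \<open>k\<close>, \<open>c\<close> and \<open>t\<close>.\<close>

lemma hermite_nonvanishing:
  fixes xs :: "complex list" and \<theta> :: "complex poly"
  assumes \<theta>: "\<And>i. coeff \<theta> i \<in> \<int>" "degree \<theta> \<le> M" "coeff \<theta> 0 = of_int t" "t \<noteq> 0"
    and roots: "\<And>x. x \<in> set xs \<Longrightarrow> [:- x, 1:] dvd \<theta>"
    and pow: "\<And>n. of_int c ^ n * (\<Sum>x\<leftarrow>xs. x ^ n) \<in> \<int>" and c: "c \<noteq> 0"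
    and p: "prime p" "p > k" "int p > \<bar>c\<bar>" "int p > \<bar>t\<bar>" "k > 0"
  defines "f \<equiv> monom 1 (p - 1) * \<theta> ^ p"
  shows "fact (p - 1) \<le> norm (of_int c ^ (M * p) * (of_nat k * hermite f 0 + (\<Sum>x\<leftarrow>xs. hermite f x)))"
proof -
  have p0: "p > 0" using p(1) by (rule prime_gt_0_nat)
  let ?N = "M * p"
  have f: "coeff f i \<in> \<int>" for i
    unfolding f_def by (intro coeff_mult_Ints coeff_power_Ints \<theta>) simp
  have "degree f \<le> (p - 1) + degree \<theta> * p"
    unfolding f_def
    by (rule order_trans[OF degree_mult_le add_mono]) (auto simp: degree_monom_eq intro: degree_power_le)
  also have "\<dots> \<le> (p - 1) + ?N" using \<theta>(2) by simp
  finally have deg: "degree f \<le> (p - 1) + ?N" .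
  have z1: "\<exists>z\<in>\<int>. (\<Sum>r\<le>degree f. fact r * (of_int c ^ ?N * (\<Sum>x\<leftarrow>xs. coeff (pcompose f [:x, 1:]) r))) = fact p * z"
  proof (rule sum_fact_multiple)
    fix r assume "r \<ge> p"
    then show "of_int c ^ ?N * (\<Sum>x\<leftarrow>xs. coeff (pcompose f [:x, 1:]) r) \<in> \<int>"
      using deg by (intro sum_list_coeff_pcompose_shift_Ints f pow) auto
  next
    fix r assume r: "r < p"
    have "coeff (pcompose f [:x, 1:]) r = 0" if "x \<in> set xs" for x
      using r roots[OF that] unfolding f_def
      by (intro coeff_pcompose_shift_root[of _ p]) (auto intro: dvd_mult dvd_power_same)
    then have "(\<Sum>x\<leftarrow>xs. coeff (pcompose f [:x, 1:]) r) = 0"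
      by (auto intro!: sum_list_0 cong: map_cong)
    then show "of_int c ^ ?N * (\<Sum>x\<leftarrow>xs. coeff (pcompose f [:x, 1:]) r) = 0"
      by simp
  qed
  have "of_int c ^ ?N * (\<Sum>x\<leftarrow>xs. hermite f x) =
      (\<Sum>r\<le>degree f. fact r * (of_int c ^ ?N * (\<Sum>x\<leftarrow>xs. coeff (pcompose f [:x, 1:]) r)))"
    unfolding hermite_altdef sum_list_sum_swap sum_distrib_left
    by (simp add: sum_list_const_mult mult.left_commute)
  with z1 obtain z1 where z1: "z1 \<in> \<int>" "of_int c ^ ?N * (\<Sum>x\<leftarrow>xs. hermite f x) = fact p * z1" by auto
  \<comment> \<open>\<open>g\<close> removes the coefficient of order \<open>p - 1\<close>, the only
    one whose term need not be a multiple of \<open>fact p\<close>.\<close>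
  define g where "g r = coeff f r - (if r = p - 1 then of_int t ^ p else 0)" for r
  have cf: "coeff f r = (if r < p - 1 then 0 else coeff (\<theta> ^ p) (r - (p - 1)))" for r
    by (simp add: f_def coeff_monom_mult)
  have c0: "coeff (\<theta> ^ p) 0 = of_int t ^ p" by (simp add: coeff_0_power \<theta>)
  have gz: "\<exists>z\<in>\<int>. (\<Sum>r\<le>degree f. fact r * g r) = fact p * z"
  proof (rule sum_fact_multiple)
    fix r assume "r \<ge> p" then show "g r \<in> \<int>" using p0 f by (auto simp: g_def)
  next
    fix r assume "r < p" then show "g r = 0" using p0 by (auto simp: g_def cf c0)
  qed
  then obtain z2 where z2: "z2 \<in> \<int>" "(\<Sum>r\<le>degree f. fact r * g r) = fact p * z2" by blast
  have "coeff f (p - 1) \<noteq> 0" using \<theta>(4) by (simp add: cf c0)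
  then have "p - 1 \<le> degree f" by (rule le_degree)
  have "hermite f 0 = (\<Sum>r\<le>degree f. fact r * g r + (if r = p - 1 then fact r * of_int t ^ p else 0))"
    unfolding hermite_altdef by (intro sum.cong) (auto simp: g_def algebra_simps)
  also have "\<dots> = fact p * z2 + fact (p - 1) * of_int t ^ p"
    using \<open>p - 1 \<le> degree f\<close> by (simp add: sum.distrib z2)
  finally have h0: "hermite f 0 = fact p * z2 + fact (p - 1) * of_int t ^ p" .
  obtain a b where ab: "z1 = of_int a" "z2 = of_int b" using z1(1) z2(1) by (auto elim!: Ints_cases)
  have fp: "(fact p :: complex) = of_nat p * fact (p - 1)" using p0 by (simp add: fact_reduce)
  define w where "w = int k * c ^ ?N * t ^ p + int p * (a + int k * c ^ ?N * b)"
  have "of_int c ^ ?N * (of_nat k * hermite f 0 + (\<Sum>x\<leftarrow>xs. hermite f x)) = 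
      of_nat k * of_int c ^ ?N * hermite f 0 + fact p * z1"
    unfolding z1(2)[symmetric] by (simp add: algebra_simps)
  also have "\<dots> = fact (p - 1) * of_int w"
    by (simp add: h0 ab fp w_def algebra_simps)
  finally have eq: "of_int c ^ ?N * (of_nat k * hermite f 0 + (\<Sum>x\<leftarrow>xs. hermite f x)) = fact (p - 1) * of_int w" .
  have "\<not> int p dvd w"
  proof
    assume "int p dvd w"
    then have "int p dvd int k * c ^ ?N * t ^ p" 
      by (simp add: w_def dvd_add_left_iff)
    moreover have pi: "prime (int p)" using p(1) by simp
    ultimately have "int p dvd int k \<or> int p dvd c \<or> int p dvd t"
      using prime_dvd_power[OF pi] by (metis prime_dvd_mult_iff)
    then show False
      using dvd_imp_le_int[OF c, of "int p"] dvd_imp_le_int[OF \<theta>(4), of "int p"] p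
      by (auto dest: dvd_imp_le)
  qed
  then have "w \<noteq> 0" by auto
  then have "1 \<le> norm (of_int w :: complex)" by (simp only: norm_of_int)
  then have "fact (p - 1) * 1 \<le> fact (p - 1) * norm (of_int w :: complex)" by (intro mult_left_mono) auto
  then show ?thesis unfolding eq norm_mult by (simp only: norm_fact)
qed

lemma exp_sum_nonzero:
  fixes xs :: "complex list" and \<theta> :: "complex poly"
  assumes \<theta>: "\<And>i. coeff \<theta> i \<in> \<int>" "coeff \<theta> 0 \<noteq> 0"
    and roots: "\<And>x. x \<in> set xs \<Longrightarrow> [:- x, 1:] dvd \<theta>"
    and pow: "\<And>n. of_int c ^ n * (\<Sum>x\<leftarrow>xs. x ^ n) \<in> \<int>" and c: "c \<noteq> 0" and k: "k > 0"
  shows "of_nat k + (\<Sum>x\<leftarrow>xs. exp x) \<noteq> 0"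
proof
  assume zero: "of_nat k + (\<Sum>x\<leftarrow>xs. exp x) = 0"
  obtain t where t: "coeff \<theta> 0 = of_int t" using \<theta>(1) by (auto elim: Ints_cases)
  have t0: "t \<noteq> 0" using t \<theta>(2) by auto
  define M where "M = degree \<theta>"
  \<comment> \<open>Chosen so that all factors depending on \<open>p\<close> are bounded by
    \<open>D x ^ p\<close>; the summand 1 in \<open>1 + norm x\<close> lets the exponent
    \<open>p - 1\<close> of the monomial be raised to \<open>p\<close>.\<close>
  define D :: "complex \<Rightarrow> real" where "D x = \<bar>of_int c\<bar> ^ M * (1 + norm x) * poly (map_poly norm \<theta>) (norm x)" for x
  have "(\<lambda>n. \<Sum>x\<leftarrow>ys. exp (norm x) * D x * (D x ^ n / fact n)) \<longlonglongrightarrow> 0" for ys :: "complex list"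
  proof (induction ys)
    case Nil
    then show ?case by simp
  next
    case (Cons a ys)
    have "(\<lambda>n. D a ^ n / fact n) \<longlonglongrightarrow> 0"
      using summable_LIMSEQ_zero[OF summable_exp_generic[of "D a"]] by (simp add: field_simps)
    from tendsto_add[OF tendsto_mult_left[OF this, of "exp (norm a) * D a"] Cons] show ?case by simp
  qed
  from order_tendstoD(2)[OF this, of 1 xs] obtain n0 where
    n0: "\<And>n. n \<ge> n0 \<Longrightarrow> (\<Sum>x\<leftarrow>xs. exp (norm x) * D x * (D x ^ n / fact n)) < 1"
    by (auto simp: eventually_sequentially)
  \<comment> \<open>Beyond \<open>n0\<close> for the analytic upper bound, which is used at
    \<open>p - 1\<close>, and beyond \<open>k\<close>, \<open>c\<close> and \<open>t\<close> for the
    arithmetic lower bound.\<close>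
  obtain p where p: "prime p" "p > n0 + k + nat \<bar>c\<bar> + nat \<bar>t\<bar>" using bigger_prime by blast
  have p0: "p > 0" using p(1) by (rule prime_gt_0_nat)
  define f where "f = monom 1 (p - 1) * \<theta> ^ p"
  have poly_norm_monom: "poly (map_poly norm (monom (1::complex) m)) u = u ^ m" for m and u :: real
    by (simp add: map_poly_monom poly_monom)
  have f_bound: "\<bar>of_int c\<bar> ^ (M * p) * poly (map_poly norm f) (norm x) \<le> D x ^ p" for x
  proof -
    have nn: "0 \<le> poly (map_poly norm \<theta>) (norm x)"
      by (simp add: poly_altdef coeff_map_poly sum_nonneg)
    have "poly (map_poly norm f) (norm x) \<le> norm x ^ (p - 1) * poly (map_poly norm (\<theta> ^ p)) (norm x)"
      unfolding f_def using poly_norm_mult_le[of "norm x" "monom 1 (p - 1)"] by (simp add: poly_norm_monom)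
    also have "\<dots> \<le> (1 + norm x) ^ p * poly (map_poly norm \<theta>) (norm x) ^ p"
    proof (rule mult_mono)
      have "norm x ^ (p - 1) \<le> (1 + norm x) ^ (p - 1)" by (intro power_mono) auto
      also have "\<dots> \<le> (1 + norm x) ^ p" by (intro power_increasing) auto
      finally show "norm x ^ (p - 1) \<le> (1 + norm x) ^ p" .
      show "poly (map_poly norm (\<theta> ^ p)) (norm x) \<le> poly (map_poly norm \<theta>) (norm x) ^ p"
        by (rule poly_norm_power_le) simp
      show "0 \<le> poly (map_poly norm (\<theta> ^ p)) (norm x)"
        by (simp add: poly_altdef coeff_map_poly sum_nonneg)
    qed simp
    finally have "\<bar>of_int c\<bar> ^ (M * p) * poly (map_poly norm f) (norm x) \<le> 
        \<bar>of_int c\<bar> ^ (M * p) * ((1 + norm x) ^ p * poly (map_poly norm \<theta>) (norm x) ^ p)"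
      by (intro mult_left_mono) auto
    also have "\<dots> = D x ^ p" by (simp add: D_def power_mult_distrib power_mult)
    finally show ?thesis .
  qed
  \<comment> \<open>The assumed vanishing of the exponential sum cancels the main term, so only
    errors controlled by \<open>hermite_bound\<close> remain.\<close>
  have "of_nat k * hermite f 0 + (\<Sum>x\<leftarrow>xs. hermite f x) = 
     hermite f 0 * (of_nat k + (\<Sum>x\<leftarrow>xs. exp x)) - (\<Sum>x\<leftarrow>xs. hermite f 0 * exp x - hermite f x)"
    by (simp add: sum_list_subtractf sum_list_const_mult distrib_left mult.commute[of _ "of_nat k"])
  then have eq: "of_nat k * hermite f 0 + (\<Sum>x\<leftarrow>xs. hermite f x) = - (\<Sum>x\<leftarrow>xs. hermite f 0 * exp x - hermite f x)"
    using zero by simp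
  have norm_sum_list: "norm (\<Sum>x\<leftarrow>ys. g x) \<le> (\<Sum>x\<leftarrow>ys. norm (g x))" for g :: "complex \<Rightarrow> complex" and ys
    by (induction ys) (auto intro: order_trans[OF norm_triangle_ineq])
  have "fact (p - 1) \<le> norm (of_int c ^ (M * p) * (of_nat k * hermite f 0 + (\<Sum>x\<leftarrow>xs. hermite f x)))"
    unfolding f_def using p by (intro hermite_nonvanishing[where t = t] \<theta> t t0 roots pow c k) (auto simp: M_def)
  also have "\<dots> \<le> \<bar>of_int c\<bar> ^ (M * p) * (\<Sum>x\<leftarrow>xs. norm (hermite f 0 * exp x - hermite f x))"
    unfolding eq norm_mult norm_minus_cancel norm_power norm_of_int by (intro mult_left_mono norm_sum_list) auto
  also have "\<dots> = (\<Sum>x\<leftarrow>xs. \<bar>of_int c\<bar> ^ (M * p) * norm (hermite f 0 * exp x - hermite f x))"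
    by (simp add: sum_list_const_mult)
  also have "\<dots> \<le> (\<Sum>x\<leftarrow>xs. exp (norm x) * D x ^ p)"
  proof (rule sum_list_mono)
    fix x
    have "\<bar>of_int c\<bar> ^ (M * p) * norm (hermite f 0 * exp x - hermite f x) \<le> 
       \<bar>of_int c\<bar> ^ (M * p) * (exp (norm x) * poly (map_poly norm f) (norm x))"
      by (intro mult_left_mono hermite_bound) auto
    also have "\<dots> = exp (norm x) * (\<bar>of_int c\<bar> ^ (M * p) * poly (map_poly norm f) (norm x))"
      by simp
    also have "\<dots> \<le> exp (norm x) * D x ^ p"
      by (intro mult_left_mono f_bound) auto
    finally show "\<bar>of_int c\<bar> ^ (M * p) * norm (hermite f 0 * exp x - hermite f x) \<le> exp (norm x) * D x ^ p" .
  qed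
  also have "\<dots> = fact (p - 1) * (\<Sum>x\<leftarrow>xs. exp (norm x) * D x * (D x ^ (p - 1) / fact (p - 1)))"
    using p0 by (simp add: sum_list_const_mult[symmetric] power_minus_mult[symmetric, of p] mult_ac)
  also have "\<dots> < fact (p - 1) * 1"
    using p by (intro mult_strict_left_mono n0) auto
  finally show False by simp
qed

section \<open>From exponential sums to the transcendence of pi\<close>

lemma rational_poly_common_denominator:
  fixes p :: "'a::field_char_0 poly"
  assumes "\<And>i. coeff p i \<in> \<rat>"
  shows "\<exists>c::int. c \<noteq> 0 \<and> (\<forall>i. of_int c * coeff p i \<in> \<int>)"
  using assms
proof (induction p)
  case 0
  then show ?case by (intro exI[of _ 1]) auto
next
  case (pCons a p)
  have "coeff p i \<in> \<rat>" for i using pCons.prems[of "Suc i"] by simp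
  then obtain c where c: "c \<noteq> 0" "\<And>i. of_int c * coeff p i \<in> \<int>" using pCons.IH by blast
  have "a \<in> \<rat>" using pCons.prems[of 0] by simp
  then obtain m n where mn: "n > 0" "a = of_int m / of_int n" by (elim Rats_cases') auto
  show ?case
  proof (intro exI[of _ "n * c"] conjI allI)
    fix i
    show "of_int (n * c) * coeff (pCons a p) i \<in> \<int>"
    proof (cases i)
      case 0
      have "of_int (n * c) * a = of_int (c * m)" using mn by simp
      then have "of_int (n * c) * a \<in> \<int>" by (metis Ints_of_int)
      then show ?thesis using 0 by simp
    next
      case (Suc j)
      have "of_int n * (of_int c * coeff p j) \<in> \<int>" by (intro Ints_mult c) auto
      then show ?thesis using Suc by (simp add: mult.assoc)
    qed
  qed (use mn c in auto)
qed

lemma fps_nth_prod_one_minus: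
  fixes xs :: "'a::field list"
  shows "fps_nth (\<Prod>x\<leftarrow>xs. 1 - fps_const x * fps_X) n = coeff (reflect_poly (\<Prod>x\<leftarrow>xs. [:- x, 1:])) n"
proof -
  have "reflect_poly [:- x, 1:] = [:1, - x:]" for x :: 'a
    by (rule poly_eqI) (auto simp: coeff_reflect_poly coeff_pCons split: nat.splits)
  moreover have "fps_of_poly [:1, - x:] = 1 - fps_const x * fps_X" for x :: 'a
    by (rule fps_ext) (auto simp: coeff_pCons split: nat.splits)
  ultimately have "(\<Prod>x\<leftarrow>xs. 1 - fps_const x * fps_X) = fps_of_poly (reflect_poly (\<Prod>x\<leftarrow>xs. [:- x, 1:]))"
    by (induction xs) (simp_all add: reflect_poly_mult fps_of_poly_mult del: mult_pCons_left)
  then show ?thesis by simp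
qed

text \<open>If \<open>exp w = -1\<close>, the product of \<open>1 + exp x\<close> over all roots
  \<open>x\<close> of \<open>P\<close> is 0. Expanded, it becomes a sum of exponentials of subset
  sums; collecting the zero sums into \<open>k\<close> gives a relation excluded by
  \<open>exp_sum_nonzero\<close>.\<close>

lemma exp_neq_minus_one_of_rational_root:
  fixes P :: "complex poly"
  assumes P: "\<And>i. coeff P i \<in> \<rat>" "P \<noteq> 0" "poly P w = 0"
  shows "exp w \<noteq> -1"
proof
  assume w: "exp w = -1"
  obtain A where A: "smult (lead_coeff P) (\<Prod>x\<in>#A. [:- x, 1:]) = P"
    using complex_poly_decompose_multiset by blast
  obtain xs where xs: "mset xs = A" using ex_mset by blast
  have Pxs: "P = smult (lead_coeff P) (\<Prod>x\<leftarrow>xs. [:- x, 1:])"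
    using A by (simp add: xs[symmetric] prod_mset_prod_list flip: mset_map)
  have lc: "lead_coeff P \<noteq> 0" using P by simp
  have T: "(\<Prod>x\<leftarrow>xs. [:- x, 1:]) = smult (inverse (lead_coeff P)) P"
    by (subst (2) Pxs) (use lc in simp)
  have "coeff (\<Prod>x\<leftarrow>xs. [:- x, 1:]) i \<in> \<rat>" for i
    unfolding T by (auto intro!: Rats_mult P)
  then have rat: "fps_nth (\<Prod>x\<leftarrow>xs. 1 - fps_const x * fps_X) n \<in> \<rat>" for n
    by (simp add: fps_nth_prod_one_minus coeff_reflect_poly)
  have "poly (\<Prod>x\<leftarrow>xs. [:- x, 1:]) w = 0" unfolding T using P by simp
  then have "w \<in> set xs" by (induction xs) auto
  then have "(\<Prod>x\<leftarrow>xs. 1 + exp x) = 0"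
    using w by (auto simp: prod_list_zero_iff intro!: image_eqI[of _ _ w])
  moreover have "(\<Prod>y\<leftarrow>ys. exp y) = exp (sum_list ys :: complex)" for ys
    by (induction ys) (auto simp: exp_add)
  moreover define bs where "bs = map sum_list (subseqs xs)"
  ultimately have zero: "(\<Sum>b\<leftarrow>bs. exp b) = 0"
    by (simp add: prod_list_one_plus_subseqs o_def)
  define gs where "gs = filter (\<lambda>b. b \<noteq> 0) bs"
  define k where "k = length (filter (\<lambda>b. b = 0) bs)"
  have "(\<Sum>b\<leftarrow>bs. exp b) = of_nat k + (\<Sum>g\<leftarrow>gs. exp g)"
    unfolding k_def gs_def by (induction bs) auto
  then have kz: "of_nat k + (\<Sum>g\<leftarrow>gs. exp g) = 0" using zero by simp
  \<comment> \<open>The empty subset has sum 0, which is what makes \<open>k\<close>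
    positive.\<close>
  have "[] \<in> set (subseqs xs)" by (induction xs) (auto simp: Let_def)
  then have "0 \<in> set bs" unfolding bs_def by force
  then have k: "k > 0" unfolding k_def by (auto simp: filter_empty_conv)
  have "(\<Prod>x\<leftarrow>bs. 1 - fps_const x * fps_X) = (\<Prod>x\<leftarrow>gs. 1 - fps_const x * fps_X)"
    unfolding gs_def by (induction bs) auto
  then have rat2: "fps_nth (\<Prod>x\<leftarrow>gs. 1 - fps_const x * fps_X) n \<in> \<rat>" for n
    using prod_one_minus_subset_sums_rational[OF rat] unfolding bs_def by simp
  define T where "T = (\<Prod>x\<leftarrow>gs. [:- x, 1:])"
  have T0: "coeff T 0 \<noteq> 0"
    unfolding T_def gs_def by (induction bs) (auto simp: coeff_mult_0)
  \<comment> \<open>Reflection is undone by a second one only because the constant term is nonzero,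
    that is, because the zero sums have been removed.\<close>
  have "T = reflect_poly (reflect_poly T)" using T0 by simp
  moreover have "coeff (reflect_poly T) i \<in> \<rat>" for i
    using rat2 by (simp add: fps_nth_prod_one_minus T_def)
  ultimately have "coeff T i \<in> \<rat>" for i by (metis coeff_reflect_poly Rats_0)
  then obtain c where c: "c \<noteq> 0" "\<And>i. of_int c * coeff T i \<in> \<int>"
    using rational_poly_common_denominator by blast
  \<comment> \<open>\<open>T\<close> is monic and \<open>of_int c * T\<close> integral, so the
    multiples \<open>c * x\<close> of the roots are algebraic integers, and Newton's identities over
    the integers apply to them.\<close>
  have pow: "of_int c ^ n * (\<Sum>x\<leftarrow>gs. x ^ n) \<in> \<int>" for n
  proof (cases n)
    case 0
    have "(\<Sum>x\<leftarrow>gs. 1::complex) = of_nat (length gs)" by (induction gs) auto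
    then show ?thesis using 0 by simp
  next
    case (Suc m)
    let ?cs = "map (\<lambda>x. of_int c * x) gs"
    have comp: "(\<Prod>x\<leftarrow>?cs. 1 - fps_const x * fps_X) = 
        (\<Prod>x\<leftarrow>gs. 1 - fps_const x * fps_X) oo (fps_const (of_int c) * fps_X)"
    proof (induction gs)
      case Nil
      then show ?case by simp
    next
      case (Cons a gs)
      have "(1 - fps_const a * fps_X) oo (fps_const (of_int c) * fps_X) = 1 - fps_const (of_int c * a) * fps_X"
      proof (rule fps_ext)
        fix n
        show "fps_nth ((1 - fps_const a * fps_X) oo (fps_const (of_int c) * fps_X)) n = fps_nth (1 - fps_const (of_int c * a) * fps_X) n"
          by (cases "n = 0 \<or> n = 1") (auto simp: fps_nth_compose_linear)
      qed
      then show ?case using Cons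
        by (simp add: fps_compose_mult_distrib)
    qed
    have int: "fps_nth (\<Prod>x\<leftarrow>?cs. 1 - fps_const x * fps_X) n \<in> \<int>" for n
    proof (cases n)
      case 0
      then show ?thesis by (induction gs) auto
    next
      case (Suc n')
      \<comment> \<open>One of the \<open>n\<close> factors \<open>c\<close> already clears the
        denominator; the remaining \<open>n'\<close> are surplus. The constant term, which has no
        such factor, is 1 and was treated apart.\<close>
      have "of_int c * coeff (reflect_poly T) n \<in> \<int>"
        using c(2) by (simp add: coeff_reflect_poly)
      then have "of_int c ^ n' * (of_int c * coeff (reflect_poly T) n) \<in> \<int>"
        by (rule Ints_mult[OF Ints_power[OF Ints_of_int]])
      moreover have "fps_nth (\<Prod>x\<leftarrow>?cs. 1 - fps_const x * fps_X) n = of_int c ^ n * coeff (reflect_poly T) n"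
        unfolding comp fps_nth_compose_linear fps_nth_prod_one_minus T_def by simp
      ultimately show ?thesis by (simp add: Suc mult_ac)
    qed
    have "(\<Sum>x\<leftarrow>?cs. x ^ Suc m) \<in> \<int>"
      by (rule power_sum_in_subring[OF _ _ _ _ _ int]) auto
    moreover have "(\<Sum>x\<leftarrow>?cs. x ^ Suc m) = of_int c ^ Suc m * (\<Sum>x\<leftarrow>gs. x ^ Suc m)"
      by (simp only: map_map o_def power_mult_distrib sum_list_const_mult)
    ultimately show ?thesis unfolding Suc by simp
  qed
  have "of_nat k + (\<Sum>g\<leftarrow>gs. exp g) \<noteq> 0"
  proof (rule exp_sum_nonzero[of "smult (of_int c) T"])
    show "[:- x, 1:] dvd smult (of_int c) T" if "x \<in> set gs" for x
    proof -
      have "[:- x, 1:] dvd T" unfolding T_def using that by (intro prod_list_dvd) auto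
      then show ?thesis by (rule dvd_smult)
    qed
  qed (use c k T0 pow in auto)
  then show False using kz by contradiction
qed

lemma even_odd_decomposition:
  fixes p :: "'a::field_char_0 poly"
  assumes "\<And>i. coeff p i \<in> \<rat>"
  shows "\<exists>E D. (\<forall>i. coeff E i \<in> \<rat>) \<and> (\<forall>i. coeff D i \<in> \<rat>) \<and> 
    p = pcompose E (monom 1 2) + monom 1 1 * pcompose D (monom 1 2)"
  using assms
proof (induction p)
  case 0
  then show ?case by (intro exI[of _ 0]) auto
next
  case (pCons a p)
  have "coeff p i \<in> \<rat>" for i using pCons.prems[of "Suc i"] by simp
  then obtain E D where ED: "\<And>i. coeff E i \<in> \<rat>" "\<And>i. coeff D i \<in> \<rat>" 
    "p = pcompose E (monom 1 2) + monom 1 1 * pcompose D (monom 1 2)" using pCons.IH by blast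
  have "a \<in> \<rat>" using pCons.prems[of 0] by simp
  moreover have "pCons a p = [:a:] + monom 1 1 * p" by (simp add: monom_altdef)
  then have "pCons a p = pcompose (pCons a D) (monom 1 2) + monom 1 1 * pcompose E (monom 1 2)"
    unfolding ED(3) by (simp add: pcompose_pCons algebra_simps monom_altdef power2_eq_square)
  ultimately show ?case using ED(1,2)
    by (intro exI[of _ "pCons a D"] exI[of _ E]) (auto simp: coeff_pCons split: nat.splits)
qed

text \<open>With \<open>p = E(X^2) + X * D(X^2)\<close>, the product of \<open>p(X)\<close> and
  \<open>p(-X)\<close> is \<open>E(X^2)^2 - X^2 * D(X^2)^2\<close>, a polynomial in
  \<open>X^2\<close> that vanishes at \<open>z\<close>. It is nonzero because \<open>E^2\<close> has
  even degree and \<open>X * D^2\<close> odd degree.\<close>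

lemma algebraic_power2:
  assumes "algebraic (z::'a::field_char_0)"
  shows "algebraic (z ^ 2)"
proof -
  obtain p where p: "\<And>i. coeff p i \<in> \<rat>" "p \<noteq> 0" "poly p z = 0"
    using assms unfolding algebraic_altdef by blast
  obtain E D where ED: "\<And>i. coeff E i \<in> \<rat>" "\<And>i. coeff D i \<in> \<rat>" 
    "p = pcompose E (monom 1 2) + monom 1 1 * pcompose D (monom 1 2)" 
    using even_odd_decomposition[OF p(1)] by blast
  let ?q = "E ^ 2 - monom 1 1 * D ^ 2"
  have "?q \<noteq> 0"
  proof
    assume q: "?q = 0"
    show False
    proof (cases "D = 0")
      case True
      then show ?thesis using q p ED(3) by simp
    next
      case False
      have "degree (E ^ 2) = 2 * degree E" by (cases "E = 0") (simp_all add: degree_power_eq)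
      moreover have "degree (monom 1 1 * D ^ 2) = 1 + 2 * degree D"
        using False by (subst degree_mult_eq) (simp_all add: degree_power_eq degree_monom_eq)
      ultimately show ?thesis using q by (metis eq_iff_diff_eq_0 double_not_eq_Suc_double plus_1_eq_Suc)
    qed
  qed
  moreover have "coeff ?q i \<in> \<rat>" for i
    using ED(1,2) by (auto simp: power2_eq_square coeff_mult intro!: Rats_diff Rats_sum Rats_mult)
  moreover have "poly E (z ^ 2) = - (z * poly D (z ^ 2))"
    using p(3) unfolding ED(3) by (simp add: poly_pcompose poly_monom add_eq_0_iff2)
  then have "poly ?q (z ^ 2) = 0"
    by (simp add: poly_monom power2_eq_square algebra_simps)
  ultimately show ?thesis unfolding algebraic_altdef by blast
qed

theorem pi_transcendental: "\<not> algebraic (complex_of_real pi)"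
proof
  assume "algebraic (complex_of_real pi)"
  \<comment> \<open>\<open>- pi ^ 2\<close> is the square of \<open>i * pi\<close>, so a rational
    annihilator of it, composed with \<open>X^2\<close>, annihilates \<open>i * pi\<close>.\<close>
  then have "algebraic (- (complex_of_real pi ^ 2))" by (intro algebraic_minus algebraic_power2)
  then obtain p where p: "\<And>i. coeff p i \<in> \<rat>" "p \<noteq> 0" "poly p (- (complex_of_real pi ^ 2)) = 0"
    unfolding algebraic_altdef by blast
  let ?q = "pcompose p (monom 1 2)"
  have "exp (\<i> * pi) \<noteq> -1"
  proof (rule exp_neq_minus_one_of_rational_root)
    show "coeff ?q i \<in> \<rat>" for i
      using p(1) by (intro coeff_pcompose_semiring_closed) auto
    show "?q \<noteq> 0" using p(2) by (simp add: pcompose_eq_0_iff degree_monom_eq)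
    show "poly ?q (\<i> * pi) = 0" using p(3) by (simp add: poly_pcompose poly_monom power_mult_distrib)
  qed
  then show False by simp
qed

subsection \<open>The zeta-regularized determinant\<close>

lemma zeta_continuation:
  "\<exists>F. F holomorphic_on - {1} \<and> (\<forall>w. Re w > 1 \<longrightarrow> ((\<lambda>j. of_nat j powr (- w)) has_sum F w) UNIV) \<and>
    F 0 = - 1 / 2 \<and> (F has_field_derivative - of_real (ln (2 * pi) / 2)) (at 0)"
proof -
  obtain Z where Z: "Z holomorphic_on UNIV" "\<And>s. Re s > 1 \<Longrightarrow> Z s = zeta_aux s" using zeta_aux_entire by blast
  define F where "F w = Z w / (w - 1)" for w
  have "F holomorphic_on - {1}"
    unfolding F_def using Z(1) by (intro holomorphic_intros) (auto intro: holomorphic_on_subset)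
  moreover have "((\<lambda>j. of_nat j powr (- w)) has_sum F w) UNIV" if w: "Re w > 1" for w
  proof -
    have "summable (\<lambda>j. norm (of_nat j powr (- w) :: complex))"
    proof (subst summable_Suc_iff[symmetric])
      have "norm (of_nat (Suc k) powr (- w) :: complex) = real (Suc k) powr (- Re w)" for k
        by (subst norm_powr_real_powr) auto
      moreover have "summable (\<lambda>k. real (Suc k) powr (- Re w))"
        using w by (subst summable_Suc_iff) (simp add: summable_real_powr_iff)
      ultimately show "summable (\<lambda>k. norm (of_nat (Suc k) powr (- w) :: complex))" by (simp only:)
    qed
    moreover have "(\<lambda>j. of_nat j powr (- w) :: complex) sums F w"
    proof -
      have "(\<Sum>k. of_nat (Suc k) powr (- w)) = F w"
        using w by (auto simp: F_def Z(2) zeta_aux_def)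
      then have "(\<lambda>k. of_nat (Suc k) powr (- w) :: complex) sums F w"
        using summable_sums[OF powr_neg_sums[OF w]] by simp
      \<comment> \<open>The added index 0 contributes nothing, since
        \<open>0 powr z = 0\<close>.\<close>
      then show ?thesis by (subst (asm) sums_Suc_iff) simp
    qed
    ultimately show ?thesis by (rule norm_summable_imp_has_sum)
  qed
  moreover have "F 0 = - 1 / 2" using zeta_aux_at_0(1)[OF Z] by (simp add: F_def)
  moreover have "(F has_field_derivative - of_real (ln (2 * pi) / 2)) (at 0)"
  proof -
    have "(Z has_field_derivative of_real (ln (2 * pi) / 2 - 1 / 2)) (at 0)"
      using holomorphic_derivI[OF Z(1) open_UNIV UNIV_I, of 0] zeta_aux_at_0(2)[OF Z] by simp
    then show ?thesis unfolding F_def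
      by (auto intro!: derivative_eq_intros simp: zeta_aux_at_0(1)[OF Z] field_simps)
  qed
  ultimately show ?thesis by blast
qed

section \<open>Zeta sums over one parity class\<close>

definition parity_tail :: "nat \<Rightarrow> nat \<Rightarrow> nat set" where
  "parity_tail c n = {j. j > n \<and> j mod 2 = c}"

text \<open>Index 0 is excluded: it adds nothing to the series, but it would make the product over
  the head vanish.\<close>

definition parity_head :: "nat \<Rightarrow> nat \<Rightarrow> nat set" where
  "parity_head c n = {j. 0 < j \<and> j \<le> n \<and> j mod 2 = c}"

lemma finite_parity_head [simp]: "finite (parity_head c n)"
  unfolding parity_head_def by (rule finite_subset[of _ "{..n}"]) auto

text \<open>For \<open>m = 4 * k + 1\<close> the base is \<open>n + 2 * k\<close>, and
  \<open>m > 1\<close> excludes \<open>n\<close> itself; for \<open>m = 4 * k + 3\<close> it is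
  \<open>n + 2 * k + 1\<close>.\<close>

lemma phi_series_parity:
  "phi_series K w (of_nat n) =
     of_nat (r1 K + r2 K) * (\<Sum>\<^sub>\<infinity>j\<in>parity_tail (n mod 2) n. of_nat j powr (- w)) +
     of_nat (r2 K) * (\<Sum>\<^sub>\<infinity>j\<in>parity_tail (Suc n mod 2) n. of_nat j powr (- w))"
proof -
  have eq: "(\<Sum>\<^sub>\<infinity>m\<in>M. ((of_nat m - 1) / 2 + of_nat n) powr (- w)) = (\<Sum>\<^sub>\<infinity>j\<in>J. of_nat j powr (- w))"
    if bij: "bij_betw (\<lambda>m. (m - 1) div 2 + n) M J" and odd: "\<And>m. m \<in> M \<Longrightarrow> odd m" for M J :: "nat set"
  proof -
    have "(of_nat m - 1) / 2 + of_nat n = (of_nat ((m - 1) div 2 + n) :: complex)" if "m \<in> M" for m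
      using odd[OF that] by (auto elim!: oddE)
    then have "(\<Sum>\<^sub>\<infinity>m\<in>M. ((of_nat m - 1) / 2 + of_nat n) powr (- w)) = 
        (\<Sum>\<^sub>\<infinity>m\<in>M. of_nat ((m - 1) div 2 + n) powr (- w))"
      by (intro infsum_cong) (simp only:)
    then show ?thesis
      using infsum_reindex_bij_betw[OF bij, of "\<lambda>j. of_nat j powr (- w)"] by simp
  qed
  have 1: "bij_betw (\<lambda>m. (m - 1) div 2 + n) {m. m > 1 \<and> m mod 4 = 1} (parity_tail (n mod 2) n)"
  proof (rule bij_betw_byWitness[of _ "\<lambda>j. 2 * (j - n) + 1"])
    have m: "\<exists>k>0. m = 4 * k + 1" if "m > 1" "m mod 4 = 1" for m :: nat
      using that mult_div_mod_eq[of 4 m] by (intro exI[of _ "m div 4"] conjI) linarith+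
    have j: "\<exists>k>0. j = 2 * k + n" if "j > n" "j mod 2 = n mod 2" for j
    proof -
      have "2 dvd j - n" by (rule mod_eq_dvd_iff_nat[THEN iffD1]) (use that in simp_all)
      then obtain k where "j - n = 2 * k" by (rule dvdE)
      then show ?thesis using that(1) by (intro exI[of _ k]) auto
    qed
    show "\<forall>m\<in>{m. m > 1 \<and> m mod 4 = 1}. 2 * ((m - 1) div 2 + n - n) + 1 = m"
    proof
      fix m :: nat assume "m \<in> {m. m > 1 \<and> m mod 4 = 1}"
      then obtain k where k: "m = 4 * k + 1" using m by blast
      show "2 * ((m - 1) div 2 + n - n) + 1 = m" unfolding k by simp
    qed
    show "\<forall>j\<in>parity_tail (n mod 2) n. (2 * (j - n) + 1 - 1) div 2 + n = j"
      by (auto simp: parity_tail_def)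
    show "(\<lambda>m. (m - 1) div 2 + n) ` {m. m > 1 \<and> m mod 4 = 1} \<subseteq> parity_tail (n mod 2) n"
    proof (rule image_subsetI)
      fix m :: nat assume "m \<in> {m. m > 1 \<and> m mod 4 = 1}"
      then obtain k where k: "k > 0" "m = 4 * k + 1" using m by blast
      have "(m - 1) div 2 + n = 2 * k + n" unfolding k(2) by simp
      then show "(m - 1) div 2 + n \<in> parity_tail (n mod 2) n"
        unfolding parity_tail_def using k(1) by simp
    qed
    show "(\<lambda>j. 2 * (j - n) + 1) ` parity_tail (n mod 2) n \<subseteq> {m. m > 1 \<and> m mod 4 = 1}"
    proof (rule image_subsetI)
      fix i assume "i \<in> parity_tail (n mod 2) n"
      then obtain k where k: "k > 0" "i = 2 * k + n" using j unfolding parity_tail_def by blast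
      have "2 * (i - n) + 1 = 4 * k + 1" unfolding k(2) by simp
      then show "2 * (i - n) + 1 \<in> {m. m > 1 \<and> m mod 4 = 1}" using k(1) by simp
    qed
  qed
  have 2: "bij_betw (\<lambda>m. (m - 1) div 2 + n) {m. m mod 4 = 3} (parity_tail (Suc n mod 2) n)"
  proof (rule bij_betw_byWitness[of _ "\<lambda>j. 2 * (j - n) + 1"])
    have m: "\<exists>k. m = 4 * k + 3" if "m mod 4 = 3" for m :: nat
      using that mult_div_mod_eq[of 4 m] by (intro exI[of _ "m div 4"]) linarith
    have j: "\<exists>k. j = 2 * k + 1 + n" if "j > n" "j mod 2 = Suc n mod 2" for j
    proof -
      have "2 dvd j - Suc n" by (rule mod_eq_dvd_iff_nat[THEN iffD1]) (use that in simp_all)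
      then obtain k where "j - Suc n = 2 * k" by (rule dvdE)
      then show ?thesis using that(1) by (intro exI[of _ k]) auto
    qed
    show "\<forall>m\<in>{m. m mod 4 = 3}. 2 * ((m - 1) div 2 + n - n) + 1 = m"
    proof
      fix m :: nat assume "m \<in> {m. m mod 4 = 3}"
      then obtain k where k: "m = 4 * k + 3" using m by blast
      show "2 * ((m - 1) div 2 + n - n) + 1 = m" unfolding k by simp
    qed
    show "\<forall>j\<in>parity_tail (Suc n mod 2) n. (2 * (j - n) + 1 - 1) div 2 + n = j"
      by (auto simp: parity_tail_def)
    show "(\<lambda>m. (m - 1) div 2 + n) ` {m. m mod 4 = 3} \<subseteq> parity_tail (Suc n mod 2) n"
    proof (rule image_subsetI)
      fix m :: nat assume "m \<in> {m. m mod 4 = 3}"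
      then obtain k where k: "m = 4 * k + 3" using m by blast
      have "(m - 1) div 2 + n = 2 * k + Suc n" using k by simp
      then show "(m - 1) div 2 + n \<in> parity_tail (Suc n mod 2) n"
        unfolding parity_tail_def by simp
    qed
    show "(\<lambda>j. 2 * (j - n) + 1) ` parity_tail (Suc n mod 2) n \<subseteq> {m. m mod 4 = 3}"
    proof (rule image_subsetI)
      fix i assume "i \<in> parity_tail (Suc n mod 2) n"
      then obtain k where k: "i = 2 * k + 1 + n" using j unfolding parity_tail_def by blast
      have "2 * (i - n) + 1 = 4 * k + 3" unfolding k by simp
      then show "2 * (i - n) + 1 \<in> {m. m mod 4 = 3}" by simp
    qed
  qed
  have 3: "odd m" if "m mod 4 = 1 \<or> m mod 4 = 3" for m :: nat using that by presburger
  show ?thesis unfolding phi_series_def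
    by (subst eq[OF 1], use 3 in blast, subst eq[OF 2], use 3 in blast, rule refl)
qed

text \<open>In the even case the derivative of \<open>2 powr (- w)\<close> contributes
  \<open>ln 2 / 2\<close>, which cancels the 2 in \<open>- ln (2 * pi) / 2\<close>. In the odd case
  only \<open>- ln 2 / 2\<close> is left. Subtracting the head adds the logarithm of its
  product.\<close>

lemma parity_zeta_continuation:
  assumes "c < 2"
  shows "\<exists>F. F holomorphic_on - {1} \<and>
    (\<forall>w. Re w > 1 \<longrightarrow> F w = (\<Sum>\<^sub>\<infinity>j\<in>parity_tail c n. of_nat j powr (- w))) \<and>
    (F has_field_derivative of_real (ln (real (\<Prod>(parity_head c n))) - ln (if c = 0 then pi else 2) / 2)) (at 0)"
proof -
  obtain Z where Z: "Z holomorphic_on - {1}" 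
    "\<And>w. Re w > 1 \<Longrightarrow> ((\<lambda>j. of_nat j powr (- w)) has_sum Z w) UNIV"
    "Z 0 = - 1 / 2" "(Z has_field_derivative - of_real (ln (2 * pi) / 2)) (at 0)"
    using zeta_continuation by blast
  define P :: "complex \<Rightarrow> complex" where "P w = (if c = 0 then 2 powr (- w) else 1 - 2 powr (- w))" for w
  define H where "H w = (\<Sum>j\<in>parity_head c n. of_nat j powr (- w) :: complex)" for w
  define F where "F w = P w * Z w - H w" for w
  have "P holomorphic_on - {1}" unfolding P_def by (cases "c = 0") (auto intro!: holomorphic_intros)
  moreover have "H holomorphic_on - {1}" unfolding H_def
    by (intro holomorphic_intros) (auto simp: parity_head_def)
  ultimately have "F holomorphic_on - {1}" unfolding F_def using Z(1) by (intro holomorphic_intros)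
  moreover have "F w = (\<Sum>\<^sub>\<infinity>j\<in>parity_tail c n. of_nat j powr (- w))" if w: "Re w > 1" for w
  proof -
    let ?f = "\<lambda>j. of_nat j powr (- w) :: complex"
    have even: "(?f has_sum 2 powr (- w) * Z w) {j. even j}"
    proof -
      have "((\<lambda>j. 2 powr (- w) * ?f j) has_sum 2 powr (- w) * Z w) UNIV"
        by (intro has_sum_cmult_right Z(2) w)
      moreover have "2 powr (- w) * ?f j = ?f (2 * j)" for j
        using powr_times_real[of 2 "of_nat j" "- w"] by simp
      ultimately have "((\<lambda>j. ?f (2 * j)) has_sum 2 powr (- w) * Z w) UNIV" by (simp only:)
      moreover have "bij_betw (\<lambda>j::nat. 2 * j) UNIV {j. even j}"
        by (rule bij_betw_byWitness[of _ "\<lambda>j. j div 2"]) auto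
      ultimately show ?thesis by (subst (asm) has_sum_reindex_bij_betw) auto
    qed
    have "(?f has_sum (Z w - 2 powr (- w) * Z w)) (UNIV - {j. even j})"
      by (rule has_sum_Diff[OF Z(2)[OF w] even]) simp
    with even have "(?f has_sum P w * Z w) {j. j mod 2 = c}"
    proof (cases "c = 0")
      case True
      then show ?thesis using even by (simp add: P_def even_iff_mod_2_eq_zero)
    next
      case False
      then have "c = 1" using assms by simp
      moreover have "UNIV - {j. even j} = {j::nat. j mod 2 = 1}" by (auto simp: odd_iff_mod_2_eq_one)
      ultimately show ?thesis using \<open>(?f has_sum (Z w - 2 powr (- w) * Z w)) (UNIV - {j. even j})\<close>
        by (simp add: P_def algebra_simps)
    qed
    moreover have "(?f has_sum H w) ({j. j mod 2 = c} \<inter> {..n})"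
    proof -
      have "(\<Sum>j\<in>{j. j mod 2 = c} \<inter> {..n}. ?f j) = H w"
        unfolding H_def by (intro sum.mono_neutral_right) (auto simp: parity_head_def)
      then show ?thesis using has_sum_finite[of "{j. j mod 2 = c} \<inter> {..n}" ?f] by simp
    qed
    ultimately have "(?f has_sum F w) ({j. j mod 2 = c} - {j. j mod 2 = c} \<inter> {..n})"
      unfolding F_def by (rule has_sum_Diff) simp
    moreover have "{j. j mod 2 = c} - {j. j mod 2 = c} \<inter> {..n} = parity_tail c n"
      by (auto simp: parity_tail_def)
    ultimately show ?thesis by (simp add: infsumI)
  qed
  moreover have "(F has_field_derivative of_real (ln (real (\<Prod>(parity_head c n))) - ln (if c = 0 then pi else 2) / 2)) (at 0)"
  proof -
    have pow: "((\<lambda>w. of_nat j powr (- w) :: complex) has_field_derivative - of_real (ln (real j))) (at 0)" if "j > 0" for j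
    proof -
      have "((\<lambda>w. of_nat j powr w :: complex) has_field_derivative Ln (of_nat j) * of_nat j powr (- 0)) (at (- 0))"
        using that by (intro has_field_derivative_powr_right) auto
      moreover have "(uminus has_field_derivative - 1) (at (0::complex))" by (auto intro!: derivative_eq_intros)
      ultimately have "((\<lambda>w. of_nat j powr (- w) :: complex) has_field_derivative (Ln (of_nat j) * of_nat j powr (- 0)) * - 1) (at 0)"
        by (rule DERIV_chain2)
      then show ?thesis using that by (simp add: Ln_of_nat)
    qed
    have "(H has_field_derivative (\<Sum>j\<in>parity_head c n. - of_real (ln (real j)))) (at 0)"
      unfolding H_def by (intro DERIV_sum pow) (simp add: parity_head_def)
    moreover have "(\<Sum>j\<in>parity_head c n. ln (real j)) = ln (real (\<Prod>(parity_head c n)))"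
      unfolding of_nat_prod by (rule ln_prod[symmetric]) (auto simp: parity_head_def)
    then have "(\<Sum>j\<in>parity_head c n. - of_real (ln (real j))) = - complex_of_real (ln (real (\<Prod>(parity_head c n))))"
      by (metis of_real_sum sum_negf)
    ultimately have H: "(H has_field_derivative - of_real (ln (real (\<Prod>(parity_head c n))))) (at 0)" by simp
    have P: "(P has_field_derivative (if c = 0 then - of_real (ln 2) else of_real (ln 2))) (at 0)"
      using pow[of 2] unfolding P_def by (cases "c = 0") (auto intro!: derivative_eq_intros)
    have "(F has_field_derivative (if c = 0 then - of_real (ln 2) else of_real (ln 2)) * Z 0 + 
        - of_real (ln (2 * pi) / 2) * P 0 - - of_real (ln (real (\<Prod>(parity_head c n))))) (at 0)"
      unfolding F_def by (intro DERIV_diff H DERIV_mult P Z(4))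
    also have "(if c = 0 then - of_real (ln 2) else of_real (ln 2)) * Z 0 + 
        - of_real (ln (2 * pi) / 2) * P 0 - - of_real (ln (real (\<Prod>(parity_head c n)))) =
        complex_of_real (ln (real (\<Prod>(parity_head c n))) - ln (if c = 0 then pi else 2) / 2)"
      by (auto simp: Z(3) P_def ln_mult algebra_simps add_divide_distrib)
    finally show ?thesis .
  qed
  ultimately show ?thesis by blast
qed

lemma G_eq:
  fixes K :: "'k::field_char_0 itself" and n :: nat
  defines "g c \<equiv> sqrt (if c = 0 then pi else 2) / real (\<Prod>(parity_head c n))"
  shows "G K (of_nat n) = of_real (g (n mod 2) ^ (r1 K + r2 K) * g (Suc n mod 2) ^ r2 K)"
proof -
  define d where "d c = ln (real (\<Prod>(parity_head c n))) - ln (if c = 0 then pi else 2) / 2" for c :: nat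
  obtain F where F: "\<And>c. c < 2 \<Longrightarrow> F c holomorphic_on - {1}"
    "\<And>c w. c < 2 \<Longrightarrow> Re w > 1 \<Longrightarrow> F c w = (\<Sum>\<^sub>\<infinity>j\<in>parity_tail c n. of_nat j powr (- w))"
    "\<And>c. c < 2 \<Longrightarrow> (F c has_field_derivative of_real (d c)) (at 0)"
  proof -
    have "\<exists>F. \<forall>c. c < 2 \<longrightarrow> F c holomorphic_on - {1} \<and>
      (\<forall>w. Re w > 1 \<longrightarrow> F c w = (\<Sum>\<^sub>\<infinity>j\<in>parity_tail c n. of_nat j powr (- w))) \<and>
      (F c has_field_derivative of_real (d c)) (at 0)"
    proof (intro choice allI)
      fix c
      show "\<exists>F. c < 2 \<longrightarrow> F holomorphic_on - {1} \<and>
        (\<forall>w. Re w > 1 \<longrightarrow> F w = (\<Sum>\<^sub>\<infinity>j\<in>parity_tail c n. of_nat j powr (- w))) \<and>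
        (F has_field_derivative of_real (d c)) (at 0)"
        using parity_zeta_continuation[of c n] unfolding d_def[symmetric] by blast
    qed
    then show ?thesis using that by blast
  qed
  define \<Phi> where "\<Phi> w = of_nat (r1 K + r2 K) * F (n mod 2) w + of_nat (r2 K) * F (Suc n mod 2) w" for w
  define Q where "Q \<Psi> \<longleftrightarrow> \<Psi> holomorphic_on (- {1}) \<and> (\<forall>z. Re z > 1 \<longrightarrow> \<Psi> z = phi_series K z (of_nat n))" for \<Psi>
  have "\<Phi> holomorphic_on - {1}" unfolding \<Phi>_def by (intro holomorphic_intros F) auto
  moreover have "\<Phi> z = phi_series K z (of_nat n)" if "Re z > 1" for z
    unfolding \<Phi>_def phi_series_parity using that by (simp add: F(2))
  ultimately have Q: "Q \<Phi>" unfolding Q_def by blast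
  define \<Psi> where "\<Psi> = (\<lambda>w. phi K w (of_nat n))"
  have "\<Psi> = (SOME \<Psi>. Q \<Psi>)" unfolding \<Psi>_def phi_def Q_def ..
  then have Q': "Q \<Psi>" using someI[of Q, OF Q] by simp
  \<comment> \<open>The choice operator is harmless: the punctured plane is connected, so any two
    continuations agree near 0.\<close>
  have eq: "\<Psi> z = \<Phi> z" if "z \<in> - {1}" for z
  proof (rule analytic_continuation_open[of "{z. Re z > 1}" "- {1}" \<Psi> \<Phi> z])
    have "2 \<in> {z. Re z > 1}" by simp
    then show "{z. Re z > 1} \<noteq> {}" by blast
    show "connected (- {1::complex})" by (rule connected_punctured_universe) simp
  qed (use Q Q' that in \<open>auto simp: Q_def open_halfspace_Re_gt\<close>)
  have "(\<Phi> has_field_derivative of_nat (r1 K + r2 K) * of_real (d (n mod 2)) + of_nat (r2 K) * of_real (d (Suc n mod 2))) (at 0)"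
    unfolding \<Phi>_def by (intro DERIV_add DERIV_cmult F) auto
  then have "(\<Psi> has_field_derivative of_nat (r1 K + r2 K) * of_real (d (n mod 2)) + of_nat (r2 K) * of_real (d (Suc n mod 2))) (at 0)"
    by (rule has_field_derivative_transform_within_open[of _ _ _ "- {1}"]) (auto simp: eq)
  then have D: "deriv \<Psi> 0 = of_nat (r1 K + r2 K) * of_real (d (n mod 2)) + of_nat (r2 K) * of_real (d (Suc n mod 2))"
    by (rule DERIV_imp_deriv)
  have g: "exp (- d c) = g c" for c
  proof -
    have pos: "real (\<Prod>(parity_head c n)) > 0" by (auto simp: parity_head_def intro!: prod_pos)
    have "exp (- d c) = exp (ln (if c = 0 then pi else 2) / 2) / exp (ln (real (\<Prod>(parity_head c n))))"
      by (simp add: d_def exp_diff[symmetric])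
    also have "exp (ln (if c = 0 then pi else 2) / 2) = sqrt (if c = 0 then pi else 2)"
    proof -
      have "exp (ln x / 2) = sqrt x" if "x > 0" for x :: real
        using that by (simp add: ln_sqrt[symmetric])
      then show ?thesis by simp
    qed
    finally show ?thesis using pos by (simp add: g_def)
  qed
  have "G K (of_nat n) = exp (of_real (real (r1 K + r2 K) * - d (n mod 2) + real (r2 K) * - d (Suc n mod 2)))"
    unfolding G_def \<Psi>_def[symmetric] D by (simp add: algebra_simps)
  also have "\<dots> = of_real (exp (real (r1 K + r2 K) * - d (n mod 2)) * exp (real (r2 K) * - d (Suc n mod 2)))"
    by (simp only: exp_of_real exp_add)
  also have "\<dots> = of_real (g (n mod 2) ^ (r1 K + r2 K) * g (Suc n mod 2) ^ r2 K)"
    by (simp only: exp_of_nat_mult g)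
  finally show ?thesis .
qed

text \<open>For \<open>e > 0\<close>, substituting \<open>q * X ^ e\<close> into a polynomial that
  annihilates \<open>z ^ 2\<close> gives one that annihilates pi. For \<open>e = 0\<close>,
  \<open>z\<close> is a root of \<open>X^2 - q\<close>.\<close>

lemma algebraic_iff_sqrt_pi_power:
  fixes z :: complex and q :: real
  assumes z: "z ^ 2 = of_real (pi ^ e * q)" and q: "q \<in> \<rat>" "q \<noteq> 0"
  shows "algebraic z \<longleftrightarrow> e = 0"
proof
  assume "e = 0"
  have q': "complex_of_real q \<in> \<rat>" using q(1) by (auto elim!: Rats_cases)
  show "algebraic z"
  proof (rule algebraicI')
    show "coeff [:- of_real q, 0, 1:] i \<in> (\<rat> :: complex set)" for i
      using q' by (auto simp: coeff_pCons split: nat.splits)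
    show "poly [:- of_real q, 0, 1:] z = 0"
      using z \<open>e = 0\<close> by (simp add: power2_eq_square)
  qed simp
next
  assume "algebraic z"
  then have "algebraic (z ^ 2)" by (rule algebraic_power2)
  then obtain p where p: "\<And>i. coeff p i \<in> \<rat>" "p \<noteq> 0" "poly p (z ^ 2) = 0"
    unfolding algebraic_altdef by blast
  have q': "complex_of_real q \<in> \<rat>" using q(1) by (auto elim!: Rats_cases)
  let ?r = "pcompose p (monom (of_real q) e)"
  show "e = 0"
  proof (rule ccontr)
    assume e: "e \<noteq> 0"
    have "algebraic (complex_of_real pi)"
    proof (rule algebraicI')
      show "coeff ?r i \<in> \<rat>" for i
        using p(1) q' by (intro coeff_pcompose_semiring_closed) auto
      show "?r \<noteq> 0" using p(2) e q(2) by (simp add: pcompose_eq_0_iff degree_monom_eq)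
      show "poly ?r (of_real pi) = 0" using p(3) by (simp add: poly_pcompose poly_monom z mult.commute)
    qed
    then show False using pi_transcendental by blast
  qed
qed

theorem theorem3:
  fixes n :: nat
  assumes "number_field TYPE('k::field_char_0)"
  shows "(even n \<longrightarrow> G TYPE('k) (of_nat n) \<notin> Qbar) \<and>
         (odd n \<longrightarrow>
            (G TYPE('k) (of_nat n) \<notin> Qbar \<longleftrightarrow> r2 TYPE('k) \<ge> 1) \<and>
            (G TYPE('k) (of_nat n) \<in> Qbar \<longleftrightarrow> r2 TYPE('k) = 0)) \<and>
         (r2 TYPE('k) = 0 \<longleftrightarrow> totally_real TYPE('k))"
proof -
  let ?a = "r1 TYPE('k) + r2 TYPE('k)" and ?b = "r2 TYPE('k)"
  define N where "N c = real (\<Prod>(parity_head c n))" for c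
  have N: "N c \<noteq> 0" "N c \<in> \<rat>" for c by (auto simp: N_def parity_head_def)
  have sq: "(G TYPE('k) (of_nat n)) ^ 2 = of_real (((if even n then pi else 2) / N (n mod 2) ^ 2) ^ ?a *
      ((if even n then 2 else pi) / N (Suc n mod 2) ^ 2) ^ ?b)"
  proof -
    have "(sqrt x / y) ^ 2 = x / y ^ 2" if "x \<ge> 0" for x y :: real
      using that by (simp add: power_divide)
    moreover have "(u ^ i * v ^ j) ^ 2 = (u ^ 2) ^ i * (v ^ 2) ^ j" for u v :: real and i j
      by (simp add: power_mult_distrib power_mult[symmetric] mult.commute)
    moreover have "n mod 2 = 0 \<longleftrightarrow> even n" "Suc n mod 2 = 0 \<longleftrightarrow> odd n" by presburger+
    ultimately show ?thesis
      unfolding G_eq of_real_power[symmetric] N_def by simp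
  qed
  have alg: "G TYPE('k) (of_nat n) \<in> Qbar \<longleftrightarrow> (if even n then ?a else ?b) = 0"
  proof -
    \<comment> \<open>The rational factor left over once pi is split off; pi belongs to the residue
      class 0, which is that of \<open>n\<close> for even \<open>n\<close> and that of
      \<open>Suc n\<close> for odd \<open>n\<close>.\<close>
    define q where "q = (if even n then (1 / N (n mod 2) ^ 2) ^ ?a * (2 / N (Suc n mod 2) ^ 2) ^ ?b
      else (2 / N (n mod 2) ^ 2) ^ ?a * (1 / N (Suc n mod 2) ^ 2) ^ ?b)"
    have "q \<in> \<rat>" "q \<noteq> 0" using N by (auto simp: q_def)
    moreover have "(G TYPE('k) (of_nat n)) ^ 2 = of_real (pi ^ (if even n then ?a else ?b) * q)"
      unfolding sq by (simp add: q_def power_divide)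
    ultimately show ?thesis unfolding Qbar_def using algebraic_iff_sqrt_pi_power by blast
  qed
  show ?thesis
    using alg r1_plus_r2_pos[OF assms] r2_eq_0_iff_totally_real[OF assms] by auto
qed

end
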